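(* For every super-reflexive Banach space $(X,\|\cdot\|_X)$ there exist $\varepsilon(X),C(X)\in(0,\infty)$ such that for every $m,n\in\mathbb N$ and every $n\times n$ symmetric stochastic matrix $A$ we have $$\gamma_+\left(\mathscr A_m(A),\|\cdot\|_X^2\right)\le C(X)\max\left\{1,\frac{\gamma_+\left(A,\|\cdot\|_X^2\right)}{m^{\varepsilon(X)}}\right\}.$$
   Context: For an $n\times n$ matrix $A$ and $m\in\mathbb N$ let $\mathscr A_m(A)=\frac1m\sum_{t=0}^{m-1}A^t$. For a symmetric function $K:X\times X\to[0,\infty)$ and an $n\times n$ symmetric stochastic matrix $A=(a_{ij})$, $\gamma_+(A,K)$ is the infimum over those $\gamma_+\in(0,\infty]$ such that for all $x_1,\ldots,x_n,y_1,\ldots,y_n\in X$, $$\frac1{n^2}\sum_{i=1}^n\sum_{j=1}^nK(x_i,y_j)\le\frac{\gamma_+}{n}\sum_{i=1}^n\sum_{j=1}^na_{ij}K(x_i,y_j).$$ The notation $\|\cdot\|_X^2$ stands for the kernel $K(x,y)=\|x-y\|_X^2$. A normed space is uniformly convex if for every $\varepsilon\in(0,1)$ there is $\delta>0$ such that $\|x\|=\|y\|=1$ and $\|x-y\|\ge\varepsilon$ imply $\|(x+y)/2\|\le1-\delta$. A normed space is super-reflexive if it admits an equivalent norm which is uniformly convex.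
   Formalization: The claim is proved for m ≥ 2 only; at m = 1 it is false, since 𝒜₁(A) is the identity, whose γ₊ is infinite for n ≥ 2 and X ≠ 0, while for A with all entries 1/n one has γ₊(A) = 1. *)

theory Defs
  imports
    "HOL-Analysis.Analysis"
    "Jordan_Normal_Form.Matrix"
begin

definition is_norm :: "('a::real_vector \<Rightarrow> real) \<Rightarrow> bool" where
  "is_norm N \<longleftrightarrow>
     (\<forall>x. 0 \<le> N x) \<and>
     (\<forall>x. N x = 0 \<longleftrightarrow> x = 0) \<and>
     (\<forall>c x. N (c *\<^sub>R x) = \<bar>c\<bar> * N x) \<and>
     (\<forall>x y. N (x + y) \<le> N x + N y)"

definition uniformly_convex :: "('a::real_vector \<Rightarrow> real) \<Rightarrow> bool" where
  "uniformly_convex N \<longleftrightarrow>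
     (\<forall>\<epsilon>::real. 0 < \<epsilon> \<and> \<epsilon> < 1 \<longrightarrow>
        (\<exists>\<delta>>0. \<forall>x y. N x = 1 \<and> N y = 1 \<and> N (x - y) \<ge> \<epsilon> \<longrightarrow>
           N ((1/2) *\<^sub>R (x + y)) \<le> 1 - \<delta>))"

definition equivalent_norm :: "('a::real_normed_vector \<Rightarrow> real) \<Rightarrow> bool" where
  "equivalent_norm N \<longleftrightarrow>
     is_norm N \<and> (\<exists>c>0. \<exists>C>0. \<forall>x. c * norm x \<le> N x \<and> N x \<le> C * norm x)"

definition super_reflexive :: "'a::real_normed_vector itself \<Rightarrow> bool" where
  "super_reflexive _ \<longleftrightarrow>
     (\<exists>N :: 'a \<Rightarrow> real. equivalent_norm N \<and> uniformly_convex N)"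

definition symmetric_stochastic :: "nat \<Rightarrow> real mat \<Rightarrow> bool" where
  "symmetric_stochastic n A \<longleftrightarrow>
     A \<in> carrier_mat n n \<and>
     transpose_mat A = A \<and>
     (\<forall>i<n. \<forall>j<n. 0 \<le> A $$ (i, j)) \<and>
     (\<forall>i<n. (\<Sum>j<n. A $$ (i, j)) = 1)"

(* The sum of matrix powers is taken entrywise, because matrices whose dimension is not part
   of the type do not form an additive monoid type. Intended for square A and m > 0.
   Note that cesaro_mat 1 A is the identity matrix, whose gamma_plus is \<top> as soon as it has size
   at least 2 and K vanishes exactly on the diagonal of a type with two points: take y = x
   nonconstant in gamma_plus. A finite upper bound can therefore only hold for m \<ge> 2. *)
definition cesaro_mat :: "nat \<Rightarrow> real mat \<Rightarrow> real mat" where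
  "cesaro_mat m A =
     mat (dim_row A) (dim_col A) (\<lambda>ij. (1 / real m) * (\<Sum>t<m. (A ^\<^sub>m t) $$ ij))"

(* Intended for nonnegative K and for n x n matrices A with nonnegative entries, n = dim_row A
   > 0; then both sums are nonnegative and the embedding of the reals into ennreal loses
   nothing. The value does not depend on the convention for \<top> * 0: whether or not \<top> belongs
   to the set below, the infimum is \<top> if no finite g does. *)
definition gamma_plus :: "real mat \<Rightarrow> ('a \<Rightarrow> 'a \<Rightarrow> real) \<Rightarrow> ennreal" where
  "gamma_plus A K =
     (let n = dim_row A in
      Inf {g :: ennreal. 0 < g \<and>
        (\<forall>x y :: nat \<Rightarrow> 'a.
           ennreal ((1 / (real n)\<^sup>2) * (\<Sum>i<n. \<Sum>j<n. K (x i) (y j)))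
             \<le> g / ennreal (real n) * ennreal (\<Sum>i<n. \<Sum>j<n. A $$ (i, j) * K (x i) (y j)))})"

definition norm_sq_kernel :: "'a::real_normed_vector \<Rightarrow> 'a \<Rightarrow> real" where
  "norm_sq_kernel x y = (norm (x - y))\<^sup>2"

end

theory Submission
  imports Defs
begin

text \<open>For a stationary Markov chain with kernel \<open>A\<close> and a function \<open>f\<close>, the variables
  \<open>A\<^sup>M\<^sup>-\<^sup>t f(X\<^sub>t)\<close> form a martingale. Uniform convexity, in a form linear in squared
  norms, shows that for some fixed length \<open>r\<close> the average of the squared increments of any such
  martingale is at most half the second moment of the total increment. Iterating over blocks, the
  average over \<open>M = r\<^sup>l\<close> increments gains the factor \<open>2\<^sup>-\<^sup>l\<close>, a negative power of \<open>M\<close>;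
  this replaces Pisier's renorming theorem. Given \<open>x\<close> and \<open>y\<close>, let \<open>z\<close> be the average of
  \<open>A\<^sup>k y\<close> over a window of length \<open>M\<close> comparable to \<open>m\<close>. The energy of the pair \<open>(A z, z)\<close>
  for \<open>A\<close> is an average of squared martingale increments, so it is \<open>O(m\<^sup>-\<^sup>\<epsilon>)\<close> times the energy
  of \<open>(x, y)\<close> for the Cesaro mean, while \<open>x - A z\<close> and \<open>y - z\<close> are bounded by the latter
  energy. The inequality for \<open>A\<close>, applied to \<open>(A z, z)\<close>, gives the claim.\<close>

section \<open>Norms and uniform convexity\<close>

lemma is_normD:
  assumes "is_norm N"
  shows is_norm_ge_0: "0 \<le> N x"
    and is_norm_eq_0: "N x = 0 \<longleftrightarrow> x = 0"
    and is_norm_scale: "N (c *\<^sub>R x) = \<bar>c\<bar> * N x"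
    and is_norm_triangle: "N (x + y) \<le> N x + N y"
  using assms unfolding is_norm_def by auto

lemma is_norm_norm: "is_norm (norm :: 'a::real_normed_vector \<Rightarrow> real)"
  unfolding is_norm_def by (auto intro: norm_triangle_ineq)

lemma is_norm_minus_commute:
  assumes "is_norm N"
  shows "N (x - y) = N (y - x)"
  using is_norm_scale[OF assms, of "-1" "y - x"] by simp

lemma is_norm_sum_le:
  assumes "is_norm N"
  shows "N (\<Sum>j\<in>J. f j) \<le> (\<Sum>j\<in>J. N (f j))"
proof (induction J rule: infinite_finite_induct)
  case (insert x F)
  then show ?case
    using is_norm_triangle[OF assms, of "f x" "\<Sum>j\<in>F. f j"] by simp
qed (simp_all add: iffD2[OF is_norm_eq_0[OF assms]])

text \<open>The triangle inequality reduces the claim to the real weights, where it says that a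
  variance is nonnegative.\<close>

lemma is_norm_jensen:
  fixes p :: "'i \<Rightarrow> real"
  assumes N: "is_norm N" and p: "\<And>j. j \<in> J \<Longrightarrow> 0 \<le> p j" "(\<Sum>j\<in>J. p j) = 1"
  shows "(N (\<Sum>j\<in>J. p j *\<^sub>R f j))\<^sup>2 \<le> (\<Sum>j\<in>J. p j * (N (f j))\<^sup>2)"
proof -
  define \<mu> where "\<mu> = (\<Sum>j\<in>J. p j * N (f j))"
  have "N (\<Sum>j\<in>J. p j *\<^sub>R f j) \<le> (\<Sum>j\<in>J. N (p j *\<^sub>R f j))"
    by (rule is_norm_sum_le[OF N])
  also have "\<dots> = \<mu>"
    unfolding \<mu>_def using p(1) by (intro sum.cong) (auto simp: is_norm_scale[OF N])
  finally have "(N (\<Sum>j\<in>J. p j *\<^sub>R f j))\<^sup>2 \<le> \<mu>\<^sup>2"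
    by (intro power_mono is_norm_ge_0[OF N])
  also have "\<mu>\<^sup>2 \<le> (\<Sum>j\<in>J. p j * (N (f j))\<^sup>2)"
  proof -
    \<comment> \<open>The variance of \<open>N (f j)\<close> under the weights \<open>p\<close>,
      expanded around its mean \<open>\<mu>\<close>.\<close>
    have "0 \<le> (\<Sum>j\<in>J. p j * (N (f j) - \<mu>)\<^sup>2)"
      using p(1) by (intro sum_nonneg) simp
    also have "\<dots> = (\<Sum>j\<in>J. p j * (N (f j))\<^sup>2 - 2 * \<mu> * (p j * N (f j)) + \<mu>\<^sup>2 * p j)"
      by (intro sum.cong) (auto simp: power2_diff algebra_simps)
    also have "\<dots> = (\<Sum>j\<in>J. p j * (N (f j))\<^sup>2) - \<mu>\<^sup>2"
      by (simp add: sum.distrib sum_subtractf sum_distrib_left[symmetric] p(2) \<mu>_def[symmetric]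
          power2_eq_square)
    finally show ?thesis by simp
  qed
  finally show ?thesis .
qed

lemma is_norm_sq_triangle:
  assumes "is_norm N"
  shows "(N (x + y))\<^sup>2 \<le> 2 * (N x)\<^sup>2 + 2 * (N y)\<^sup>2"
proof -
  have "(N (x + y))\<^sup>2 \<le> (N x + N y)\<^sup>2"
    by (intro power_mono is_norm_triangle is_norm_ge_0 assms)
  also have "\<dots> \<le> 2 * (N x)\<^sup>2 + 2 * (N y)\<^sup>2"
    using sum_squares_bound[of "N x" "N y"] by (simp add: power2_sum)
  finally show ?thesis .
qed

text \<open>The definition compares unit vectors only; here the separation is relative to the longer
  vector. If the lengths differ markedly, strict convexity of the square gives the gain; otherwise
  both vectors are rescaled to the unit sphere.\<close>

lemma uniformly_convex_far:
  assumes N: "is_norm N" and uc: "uniformly_convex N" and "0 < \<eta>" "\<eta> \<le> 1"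
  obtains \<delta> where "0 < \<delta>" "\<delta> \<le> 1"
    "\<And>u v. N v \<le> N u \<Longrightarrow> \<eta> * N u \<le> N (u - v) \<Longrightarrow>
       (N ((1/2) *\<^sub>R (u + v)))\<^sup>2 \<le> (1 - \<delta>) * (((N u)\<^sup>2 + (N v)\<^sup>2) / 2)"
proof -
  \<comment> \<open>Up to half of the separation may come from the difference of lengths; halving
    also keeps the parameter below 1 when \<open>\<eta> = 1\<close>.\<close>
  have "0 < \<eta>/2 \<and> \<eta>/2 < 1" using assms by auto
  with uc have "\<exists>\<delta>>0. \<forall>x y. N x = 1 \<and> N y = 1 \<and> N (x - y) \<ge> \<eta>/2 \<longrightarrow>
      N ((1/2) *\<^sub>R (x + y)) \<le> 1 - \<delta>"
    unfolding uniformly_convex_def by (elim allE[of _ "\<eta>/2"] impE)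
  then obtain \<delta>1 where d1: "\<delta>1 > 0"
    and uc': "\<And>x y. N x = 1 \<Longrightarrow> N y = 1 \<Longrightarrow> N (x - y) \<ge> \<eta>/2 \<Longrightarrow> N ((1/2) *\<^sub>R (x + y)) \<le> 1 - \<delta>1"
    by auto
  define \<delta>2 where "\<delta>2 = min \<delta>1 1"
  have d2: "0 < \<delta>2" "\<delta>2 \<le> 1" "\<delta>2 \<le> \<delta>1" using d1 by (auto simp: \<delta>2_def)
  \<comment> \<open>The first entry is the gain for unequal lengths, the second the gain on the unit
    sphere.\<close>
  define \<delta> where "\<delta> = min (\<eta>\<^sup>2 / 16) (\<delta>2 / 2)"
  have d: "0 < \<delta>" "\<delta> \<le> 1" "\<delta> \<le> \<eta>\<^sup>2/16" "\<delta> \<le> \<delta>2/2"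
    using d2 assms by (auto simp: \<delta>_def)
  have "(N ((1/2) *\<^sub>R (u + v)))\<^sup>2 \<le> (1 - \<delta>) * (((N u)\<^sup>2 + (N v)\<^sup>2) / 2)"
    if le: "N v \<le> N u" and far: "\<eta> * N u \<le> N (u - v)" for u v
  proof -
    define a b where "a = N u" and "b = N v"
    have ab: "0 \<le> b" "b \<le> a" using le is_norm_ge_0[OF N] by (auto simp: a_def b_def)
    have mid: "N ((1/2) *\<^sub>R (u + v)) \<le> (a + b) / 2"
      using is_norm_triangle[OF N, of u v] is_norm_scale[OF N, of "1/2" "u+v"]
      by (simp add: a_def b_def)
    show ?thesis
    proof (cases "b \<le> (1 - \<eta>/2) * a")
      case True
      have "(N ((1/2) *\<^sub>R (u + v)))\<^sup>2 \<le> ((a + b)/2)\<^sup>2"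
        by (intro power_mono mid is_norm_ge_0[OF N])
      also have "\<dots> = (a\<^sup>2 + b\<^sup>2)/2 - (a - b)\<^sup>2 / 4"
        by (simp add: power2_eq_square field_simps)
      also have "(\<eta>/2 * a)\<^sup>2 \<le> (a - b)\<^sup>2"
        using True assms ab by (intro power_mono) (auto simp: algebra_simps)
      then have "(a\<^sup>2 + b\<^sup>2)/2 - (a - b)\<^sup>2 / 4 \<le> (a\<^sup>2 + b\<^sup>2)/2 - \<eta>\<^sup>2/16 * a\<^sup>2"
        by (simp add: power_mult_distrib power_divide)
      also have "\<dots> \<le> (a\<^sup>2 + b\<^sup>2)/2 - \<delta> * ((a\<^sup>2+b\<^sup>2)/2)"
      proof -
        have "b\<^sup>2 \<le> a\<^sup>2" using ab by (intro power_mono)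
        then have "\<delta> * ((a\<^sup>2+b\<^sup>2)/2) \<le> \<eta>\<^sup>2/16 * a\<^sup>2"
          using d by (intro mult_mono) auto
        then show ?thesis by simp
      qed
      also have "\<dots> = (1 - \<delta>) * ((a\<^sup>2+b\<^sup>2)/2)" by (simp only: left_diff_distrib mult_1)
      finally show ?thesis by (simp only: a_def b_def)
    next
      case False
      then have b: "b > (1 - \<eta>/2) * a" by simp
      \<comment> \<open>Since \<open>\<eta> \<le> 1\<close>, comparable lengths force
        \<open>b > a/2\<close>, so both vectors are nonzero and can be normalised.\<close>
      have "(1/2) * a \<le> (1 - \<eta>/2) * a" using assms ab by (intro mult_right_mono) auto
      then have b2: "b > a/2" using b by simp
      then have a0: "0 < a" "0 < b" using ab by auto
      define x y where "x = (1/a) *\<^sub>R u" and "y = (1/b) *\<^sub>R v"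
      have xy: "N x = 1" "N y = 1" "u = a *\<^sub>R x" "v = b *\<^sub>R y"
        using a0 is_norm_scale[OF N] by (auto simp: x_def y_def a_def b_def)
      have "\<eta> * a \<le> N (u - v)" using far by (simp add: a_def)
      also have "u - v = a *\<^sub>R (x - y) + (a - b) *\<^sub>R y"
        by (simp add: xy algebra_simps)
      also have "N \<dots> \<le> a * N (x - y) + (a - b)"
        using is_norm_triangle[OF N, of "a *\<^sub>R (x - y)" "(a - b) *\<^sub>R y"] ab a0
        by (simp add: is_norm_scale[OF N] xy)
      also have "a - b \<le> \<eta>/2 * a" using b by (simp add: algebra_simps)
      finally have "a * (\<eta>/2) \<le> a * N (x - y)" by (simp add: algebra_simps)
      then have "\<eta>/2 \<le> N (x - y)" using a0 mult_le_cancel_left_pos[of a] by blast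
      then have m: "N ((1/2) *\<^sub>R (x + y)) \<le> 1 - \<delta>2"
        using uc'[OF xy(1,2)] d2 by force
      \<comment> \<open>Shortening \<open>u\<close> to length \<open>b\<close> turns the midpoint
        into a multiple of the one on the sphere; the rest has norm
        \<open>(a - b)/2\<close>.\<close>
      have "(1/2) *\<^sub>R (u + v) = b *\<^sub>R ((1/2) *\<^sub>R (x + y)) + ((a - b)/2) *\<^sub>R x"
        unfolding xy(3,4) by (simp add: algebra_simps diff_divide_distrib)
      then have "N ((1/2) *\<^sub>R (u + v)) \<le> N (b *\<^sub>R ((1/2) *\<^sub>R (x + y))) + N (((a - b)/2) *\<^sub>R x)"
        using is_norm_triangle[OF N] by metis
      also have "\<dots> = b * N ((1/2) *\<^sub>R (x + y)) + (a - b)/2"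
        unfolding is_norm_scale[OF N, of b] is_norm_scale[OF N, of "(a - b)/2"] xy(1)
        using ab by simp
      also have "\<dots> \<le> b * (1 - \<delta>2) + (a - b)/2"
        using m a0 by simp
      also have "\<dots> = (a + b)/2 - b * \<delta>2" by (simp add: field_simps)
      also have "\<dots> \<le> (a + b)/2 - (a + b)/2 * (\<delta>2/2)"
      proof -
        have "(a + b)/2 * (\<delta>2/2) = ((a + b)/4) * \<delta>2" by simp
        also have "\<dots> \<le> b * \<delta>2" using d2 b2 a0 by (intro mult_right_mono) auto
        finally show ?thesis by simp
      qed
      also have "\<dots> = (1 - \<delta>2/2) * ((a + b)/2)" by (simp add: field_simps)
      finally have "(N ((1/2) *\<^sub>R (u + v)))\<^sup>2 \<le> ((1 - \<delta>2/2) * ((a + b)/2))\<^sup>2"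
        by (intro power_mono is_norm_ge_0[OF N])
      also have "\<dots> = (1 - \<delta>2/2)\<^sup>2 * ((a + b)/2)\<^sup>2" by (rule power_mult_distrib)
      also have "\<dots> \<le> (1 - \<delta>) * ((a\<^sup>2 + b\<^sup>2)/2)"
      proof (rule mult_mono)
        have "(1 - \<delta>2/2)\<^sup>2 \<le> 1 - \<delta>2/2"
          using d2 power_decreasing[of 1 2 "1 - \<delta>2/2"] by simp
        then show "(1 - \<delta>2/2)\<^sup>2 \<le> 1 - \<delta>" using d by simp
        show "((a + b)/2)\<^sup>2 \<le> (a\<^sup>2 + b\<^sup>2)/2"
          using sum_squares_bound[of a b] by (simp add: power2_sum power_divide)
      qed (use d in auto)
      finally show ?thesis by (simp add: a_def b_def)
    qed
  qed
  with d show thesis by (intro that[of \<delta>]) auto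
qed

text \<open>The form of uniform convexity that survives integration: it is linear in squared norms,
  so it passes from \<open>X\<close> to \<open>L\<^sub>2(X)\<close> for free.\<close>

lemma uniformly_convex_midpoint:
  assumes N: "is_norm N" and uc: "uniformly_convex N" and \<eta>: "0 < \<eta>" "\<eta> \<le> 1"
  obtains \<delta> where "0 < \<delta>"
    "\<And>u v. (N ((1/2) *\<^sub>R (u + v)))\<^sup>2 + \<delta> * (N (u - v))\<^sup>2 \<le> (1/2 + \<delta> * \<eta>) * ((N u)\<^sup>2 + (N v)\<^sup>2)"
proof -
  obtain \<delta>0 where d0: "0 < \<delta>0" "\<delta>0 \<le> 1"
    and far: "\<And>u v. N v \<le> N u \<Longrightarrow> \<eta> * N u \<le> N (u - v) \<Longrightarrow>
       (N ((1/2) *\<^sub>R (u + v)))\<^sup>2 \<le> (1 - \<delta>0) * (((N u)\<^sup>2 + (N v)\<^sup>2) / 2)"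
    using uniformly_convex_far[OF N uc \<eta>] by blast
  \<comment> \<open>For separated vectors the squared distance is at most twice the sum of squares,
    so a quarter of \<open>\<delta>0\<close> uses up exactly the gain in \<open>far\<close>.\<close>
  define \<delta> where "\<delta> = \<delta>0 / 4"
  have ordered: "(N ((1/2) *\<^sub>R (u + v)))\<^sup>2 + \<delta> * (N (u - v))\<^sup>2 \<le> (1/2 + \<delta> * \<eta>) * ((N u)\<^sup>2 + (N v)\<^sup>2)"
    if le: "N v \<le> N u" for u v
  proof (cases "\<eta> * N u \<le> N (u - v)")
    case True
    have "(N (u + (-v)))\<^sup>2 \<le> 2 * (N u)\<^sup>2 + 2 * (N (-v))\<^sup>2"
      by (rule is_norm_sq_triangle[OF N])
    moreover have "N (-v) = N v" using is_norm_scale[OF N, of "-1" v] by simp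
    ultimately have "\<delta> * (N (u - v))\<^sup>2 \<le> \<delta> * (2 * (N u)\<^sup>2 + 2 * (N v)\<^sup>2)"
      using d0 by (intro mult_left_mono) (auto simp: \<delta>_def)
    moreover have "0 \<le> \<delta> * \<eta> * ((N u)\<^sup>2 + (N v)\<^sup>2)" using d0 \<eta> by (simp add: \<delta>_def)
    ultimately show ?thesis using far[OF le True] by (simp add: \<delta>_def algebra_simps)
  next
    case False
    \<comment> \<open>For close vectors plain convexity bounds the midpoint, and the squared
      distance is small enough for the error term with \<open>\<eta>\<close>.\<close>
    have "N ((1/2) *\<^sub>R (u + v)) = N (u + v) / 2" by (subst is_norm_scale[OF N]) simp
    then have "(N ((1/2) *\<^sub>R (u + v)))\<^sup>2 = (N (u + v))\<^sup>2 / 4"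
      by (simp only: power_divide) simp
    then have "(N ((1/2) *\<^sub>R (u + v)))\<^sup>2 \<le> ((N u)\<^sup>2 + (N v)\<^sup>2) / 2"
      using is_norm_sq_triangle[OF N, of u v] by simp
    moreover have "\<delta> * (N (u - v))\<^sup>2 \<le> \<delta> * (\<eta> * ((N u)\<^sup>2 + (N v)\<^sup>2))"
    proof (rule mult_left_mono)
      have "(N (u - v))\<^sup>2 \<le> (\<eta> * N u)\<^sup>2"
        using False is_norm_ge_0[OF N] by (intro power_mono) auto
      also have "\<dots> = \<eta> * (\<eta> * (N u)\<^sup>2)" by (simp add: power2_eq_square)
      also have "\<dots> \<le> \<eta> * ((N u)\<^sup>2 + (N v)\<^sup>2)"
        using \<eta> mult_right_mono[of \<eta> 1 "(N u)\<^sup>2"]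
        by (intro mult_left_mono) (auto intro: order_trans[of _ "(N u)\<^sup>2"])
      finally show "(N (u - v))\<^sup>2 \<le> \<eta> * ((N u)\<^sup>2 + (N v)\<^sup>2)" .
    qed (use d0 in \<open>simp add: \<delta>_def\<close>)
    ultimately show ?thesis by (simp add: algebra_simps)
  qed
  have "(N ((1/2) *\<^sub>R (u + v)))\<^sup>2 + \<delta> * (N (u - v))\<^sup>2 \<le> (1/2 + \<delta> * \<eta>) * ((N u)\<^sup>2 + (N v)\<^sup>2)" for u v
  proof (cases "N v \<le> N u")
    case True
    then show ?thesis by (rule ordered)
  next
    case False
    then show ?thesis
      using ordered[of u v] is_norm_minus_commute[OF N, of u v] by (simp add: add.commute)
  qed
  then show thesis using d0 that[of \<delta>] by (simp add: \<delta>_def)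
qed

section \<open>Doubly stochastic matrices acting on vector-valued functions\<close>

text \<open>Column sums equal to 1 make the uniform distribution stationary. Unlike symmetry, this
  survives arbitrary products.\<close>

definition doubly_stochastic :: "nat \<Rightarrow> real mat \<Rightarrow> bool" where
  "doubly_stochastic n B \<longleftrightarrow>
     B \<in> carrier_mat n n \<and> (\<forall>i<n. \<forall>j<n. 0 \<le> B $$ (i, j)) \<and>
     (\<forall>i<n. (\<Sum>j<n. B $$ (i, j)) = 1) \<and> (\<forall>j<n. (\<Sum>i<n. B $$ (i, j)) = 1)"

text \<open>Outside the index range the function is left alone, so that the identity matrix acts as
  the identity.\<close>

definition mat_act :: "real mat \<Rightarrow> (nat \<Rightarrow> 'a::real_vector) \<Rightarrow> nat \<Rightarrow> 'a" where
  "mat_act B f i = (if i < dim_row B then \<Sum>j<dim_col B. B $$ (i, j) *\<^sub>R f j else f i)"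

text \<open>For a stationary Markov chain with kernel \<open>B\<close> this is, up to the factor \<open>n\<close>, the second
  moment of the martingale difference \<open>f(X\<^sub>1) - E[f(X\<^sub>1) | X\<^sub>0]\<close>.\<close>

definition dispersion :: "('a::real_vector \<Rightarrow> real) \<Rightarrow> nat \<Rightarrow> real mat \<Rightarrow> (nat \<Rightarrow> 'a) \<Rightarrow> real" where
  "dispersion N n B f = (\<Sum>i<n. \<Sum>j<n. B $$ (i, j) * (N (f j - mat_act B f i))\<^sup>2)"

lemma doubly_stochasticD:
  assumes "doubly_stochastic n B"
  shows "B \<in> carrier_mat n n" "\<And>i j. i < n \<Longrightarrow> j < n \<Longrightarrow> 0 \<le> B $$ (i, j)"
    "\<And>i. i < n \<Longrightarrow> (\<Sum>j<n. B $$ (i, j)) = 1" "\<And>j. j < n \<Longrightarrow> (\<Sum>i<n. B $$ (i, j)) = 1"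
  using assms unfolding doubly_stochastic_def by auto

section \<open>Products and powers as composed averaging operators\<close>

lemma mat_mult_entry:
  assumes "B \<in> carrier_mat n n" "C \<in> carrier_mat n n" "i < n" "k < n"
  shows "(B * C) $$ (i, k) = (\<Sum>j<n. B $$ (i, j) * C $$ (j, k) :: 'a::semiring_0)"
  using assms by (auto simp: scalar_prod_def lessThan_atLeast0 intro!: sum.cong)

lemma mat_act_eq:
  assumes "B \<in> carrier_mat n n" "i < n"
  shows "mat_act B f i = (\<Sum>j<n. B $$ (i, j) *\<^sub>R f j)"
  using assms by (auto simp: mat_act_def)

lemma mat_act_one: "mat_act (1\<^sub>m n) f = f"
proof
  fix i
  show "mat_act (1\<^sub>m n) f i = f i"
    by (cases "i < n") (simp_all add: mat_act_def if_distrib[of "\<lambda>c. c *\<^sub>R _"] sum.delta' cong: if_cong)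
qed

lemma mat_act_mult:
  assumes "B \<in> carrier_mat n n" "C \<in> carrier_mat n n"
  shows "mat_act (B * C) f = mat_act B (mat_act C f)"
proof
  fix i
  show "mat_act (B * C) f i = mat_act B (mat_act C f) i"
  proof (cases "i < n")
    case True
    have BC: "B * C \<in> carrier_mat n n" using assms by simp
    have "mat_act (B * C) f i = (\<Sum>k<n. \<Sum>j<n. (B $$ (i, j) * C $$ (j, k)) *\<^sub>R f k)"
      using assms True
      by (simp add: mat_act_eq[OF BC True] mat_mult_entry scaleR_sum_left del: index_mult_mat)
    also have "\<dots> = (\<Sum>j<n. \<Sum>k<n. (B $$ (i, j) * C $$ (j, k)) *\<^sub>R f k)"
      by (rule sum.swap)
    also have "\<dots> = mat_act B (mat_act C f) i"
      using assms True by (simp add: mat_act_eq scaleR_sum_right)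
    finally show ?thesis .
  next
    case False
    then show ?thesis using assms by (simp add: mat_act_def)
  qed
qed

lemma doubly_stochastic_one: "doubly_stochastic n (1\<^sub>m n)"
  unfolding doubly_stochastic_def by (auto simp: sum.delta sum.delta')

lemma doubly_stochastic_mult:
  assumes B: "doubly_stochastic n B" and C: "doubly_stochastic n C"
  shows "doubly_stochastic n (B * C)"
  unfolding doubly_stochastic_def
proof (intro conjI allI impI)
  note b = doubly_stochasticD[OF B] and c = doubly_stochasticD[OF C]
  note entry = mat_mult_entry[OF b(1) c(1)]
  show "B * C \<in> carrier_mat n n" using b(1) c(1) by simp
  show "0 \<le> (B * C) $$ (i, j)" if "i < n" "j < n" for i j
    unfolding entry[OF that] using b(2) c(2) that by (intro sum_nonneg) simp
  show "(\<Sum>k<n. (B * C) $$ (i, k)) = 1" if i: "i < n" for i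
  proof -
    have "(\<Sum>k<n. (B * C) $$ (i, k)) = (\<Sum>k<n. \<Sum>j<n. B $$ (i, j) * C $$ (j, k))"
      using i by (intro sum.cong) (simp_all add: entry del: index_mult_mat)
    also have "\<dots> = (\<Sum>j<n. B $$ (i, j) * (\<Sum>k<n. C $$ (j, k)))"
      by (subst sum.swap) (simp add: sum_distrib_left)
    finally show ?thesis using b(3) c(3) i by simp
  qed
  show "(\<Sum>i<n. (B * C) $$ (i, k)) = 1" if k: "k < n" for k
  proof -
    have "(\<Sum>i<n. (B * C) $$ (i, k)) = (\<Sum>i<n. \<Sum>j<n. B $$ (i, j) * C $$ (j, k))"
      using k by (intro sum.cong) (simp_all add: entry del: index_mult_mat)
    also have "\<dots> = (\<Sum>j<n. (\<Sum>i<n. B $$ (i, j)) * C $$ (j, k))"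
      by (subst sum.swap) (simp add: sum_distrib_right)
    finally show ?thesis using b(4) c(4) k by simp
  qed
qed

lemma doubly_stochastic_pow:
  assumes "doubly_stochastic n B"
  shows "doubly_stochastic n (B ^\<^sub>m k)"
proof (induction k)
  case 0
  then show ?case using doubly_stochasticD(1)[OF assms] doubly_stochastic_one by simp
next
  case (Suc k)
  then show ?case using assms by (simp add: doubly_stochastic_mult)
qed

lemma pow_mat_add:
  assumes "B \<in> carrier_mat n n"
  shows "B ^\<^sub>m (k + l) = B ^\<^sub>m k * B ^\<^sub>m l"
proof (induction l)
  case 0
  then show ?case using assms by (simp add: right_mult_one_mat)
next
  case (Suc l)
  have "B ^\<^sub>m (k + Suc l) = (B ^\<^sub>m k * B ^\<^sub>m l) * B" using Suc by simp
  also have "\<dots> = B ^\<^sub>m k * (B ^\<^sub>m l * B)"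
    using assms by (intro assoc_mult_mat) auto
  finally show ?case by simp
qed

lemma pow_mat_mult:
  assumes "B \<in> carrier_mat n n"
  shows "B ^\<^sub>m (k * l) = (B ^\<^sub>m k) ^\<^sub>m l"
proof (induction l)
  case 0
  then show ?case using assms by simp
next
  case (Suc l)
  have "B ^\<^sub>m (k * Suc l) = B ^\<^sub>m (k * l + k)" by (simp add: add.commute)
  then show ?case using Suc by (simp add: pow_mat_add[OF assms])
qed

lemma pow_mat_symmetric:
  fixes B :: "'a::comm_semiring_1 mat"
  assumes B: "B \<in> carrier_mat n n" and sym: "transpose_mat B = B"
  shows "transpose_mat (B ^\<^sub>m k) = B ^\<^sub>m k"
proof (induction k)
  case 0
  then show ?case by simp
next
  case (Suc k)
  have "transpose_mat (B ^\<^sub>m Suc k) = transpose_mat B * transpose_mat (B ^\<^sub>m k)"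
    using transpose_mult[OF pow_carrier_mat[OF B] B] by simp
  also have "\<dots> = B ^\<^sub>m 1 * B ^\<^sub>m k" using Suc sym B by (simp add: left_mult_one_mat)
  also have "\<dots> = B ^\<^sub>m Suc k" using pow_mat_add[OF B, of 1 k] by simp
  finally show ?case .
qed

lemma symmetric_stochastic_imp_doubly_stochastic:
  assumes "symmetric_stochastic n A"
  shows "doubly_stochastic n A"
proof -
  have A: "A \<in> carrier_mat n n" "transpose_mat A = A"
    using assms by (auto simp: symmetric_stochastic_def)
  have "A $$ (i, j) = A $$ (j, i)" if "i < n" "j < n" for i j
    using A that index_transpose_mat(1)[of j A i] by auto
  then have "(\<Sum>i<n. A $$ (i, j)) = (\<Sum>i<n. A $$ (j, i))" if "j < n" for j
    using that by (intro sum.cong) auto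
  then show ?thesis
    using assms by (auto simp: symmetric_stochastic_def doubly_stochastic_def)
qed

section \<open>The martingale inequality\<close>

text \<open>Conditional Jensen: row \<open>j\<close> is a probability vector, so the constant
  \<open>w\<close> can be moved into the average.\<close>

lemma mat_act_jensen:
  assumes N: "is_norm N" and C: "doubly_stochastic n C" and j: "j < n"
  shows "(N (mat_act C f j - w))\<^sup>2 \<le> (\<Sum>k<n. C $$ (j, k) * (N (f k - w))\<^sup>2)"
proof -
  note c = doubly_stochasticD[OF C]
  have "mat_act C f j - w = (\<Sum>k<n. C $$ (j, k) *\<^sub>R f k) - (\<Sum>k<n. C $$ (j, k)) *\<^sub>R w"
    using c(3)[OF j] by (simp add: mat_act_eq[OF c(1) j])
  also have "\<dots> = (\<Sum>k<n. C $$ (j, k) *\<^sub>R (f k - w))"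
    by (simp add: scaleR_sum_left sum_subtractf scaleR_diff_right)
  finally show ?thesis
    using is_norm_jensen[OF N, of "{..<n}" "\<lambda>k. C $$ (j, k)" "\<lambda>k. f k - w"] c j by simp
qed

text \<open>The tower property: a two-step expectation is computed by conditioning on the
  intermediate state \<open>j\<close>.\<close>

lemma sum_mat_mult:
  fixes G :: "nat \<Rightarrow> nat \<Rightarrow> real"
  assumes "B \<in> carrier_mat n n" "C \<in> carrier_mat n n"
  shows "(\<Sum>i<n. \<Sum>k<n. (B * C) $$ (i, k) * G i k) =
    (\<Sum>i<n. \<Sum>j<n. B $$ (i, j) * (\<Sum>k<n. C $$ (j, k) * G i k))"
proof (rule sum.cong[OF refl])
  fix i assume "i \<in> {..<n}"
  then have "(\<Sum>k<n. (B * C) $$ (i, k) * G i k) = (\<Sum>k<n. \<Sum>j<n. B $$ (i, j) * (C $$ (j, k) * G i k))"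
    using assms by (intro sum.cong)
      (auto simp: mat_mult_entry sum_distrib_right mult.assoc simp del: index_mult_mat)
  also have "\<dots> = (\<Sum>j<n. B $$ (i, j) * (\<Sum>k<n. C $$ (j, k) * G i k))"
    by (subst sum.swap) (simp add: sum_distrib_left)
  finally show "(\<Sum>k<n. (B * C) $$ (i, k) * G i k) = \<dots>" .
qed

lemma dispersion_mult:
  assumes B: "doubly_stochastic n B" and C: "doubly_stochastic n C"
  shows "dispersion N n (B * C) f =
    (\<Sum>i<n. \<Sum>j<n. B $$ (i, j) * (\<Sum>k<n. C $$ (j, k) * (N (f k - mat_act B (mat_act C f) i))\<^sup>2))"
  using doubly_stochasticD(1)[OF B] doubly_stochasticD(1)[OF C]
  by (simp add: dispersion_def mat_act_mult sum_mat_mult del: index_mult_mat)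

text \<open>Squared norms of a martingale increase in mean: stopping at the intermediate time
  replaces \<open>f\<close> by its conditional expectation.\<close>

lemma dispersion_mat_act_le:
  assumes N: "is_norm N" and B: "doubly_stochastic n B" and C: "doubly_stochastic n C"
  shows "dispersion N n B (mat_act C f) \<le> dispersion N n (B * C) f"
  unfolding dispersion_mult[OF B C] unfolding dispersion_def
  using doubly_stochasticD(2)[OF B]
  by (intro sum_mono mult_left_mono mat_act_jensen[OF N C]) auto

text \<open>With \<open>r < s < t\<close> and transition kernels \<open>B\<close>, \<open>C\<close>, the midpoint inequality is applied to
  \<open>M\<^sub>s - M\<^sub>r\<close> and \<open>M\<^sub>t - M\<^sub>r\<close>; the conditional expectation of their average given the past
  of \<open>s\<close> is \<open>M\<^sub>s - M\<^sub>r\<close>.\<close>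

lemma dispersion_step:
  assumes N: "is_norm N" and B: "doubly_stochastic n B" and C: "doubly_stochastic n C"
    and mid: "\<And>u v. (N ((1/2) *\<^sub>R (u + v)))\<^sup>2 + \<delta> * (N (u - v))\<^sup>2 \<le> \<kappa> * ((N u)\<^sup>2 + (N v)\<^sup>2)"
  shows "dispersion N n B (mat_act C f) + \<delta> * dispersion N n C f
    \<le> \<kappa> * (dispersion N n B (mat_act C f) + dispersion N n (B * C) f)"
proof -
  note b = doubly_stochasticD[OF B] and c = doubly_stochasticD[OF C]
  define u where "u i j = mat_act C f j - mat_act B (mat_act C f) i" for i j
  define v where "v i k = f k - mat_act B (mat_act C f) i" for i k
  have uv: "u i j - v i k = mat_act C f j - f k" for i j k by (simp add: u_def v_def)
  have pt: "(N (u i j))\<^sup>2 + \<delta> * (\<Sum>k<n. C $$ (j, k) * (N (f k - mat_act C f j))\<^sup>2)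
      \<le> \<kappa> * ((N (u i j))\<^sup>2 + (\<Sum>k<n. C $$ (j, k) * (N (v i k))\<^sup>2))" if j: "j < n" for i j
  proof -
    \<comment> \<open>By the martingale property \<open>v i k\<close> has conditional mean
      \<open>u i j\<close>, so averaging the midpoints over \<open>k\<close> gives back
      \<open>u i j\<close>.\<close>
    have "(\<Sum>k<n. C $$ (j, k) *\<^sub>R ((1/2) *\<^sub>R (u i j + v i k)))
        = (1/2) *\<^sub>R (\<Sum>k<n. C $$ (j, k) *\<^sub>R f k + C $$ (j, k) *\<^sub>R (u i j - mat_act B (mat_act C f) i))"
      unfolding scaleR_sum_right by (intro sum.cong) (simp_all add: v_def algebra_simps)
    also have "\<dots> = (1/2) *\<^sub>R (mat_act C f j + (u i j - mat_act B (mat_act C f) i))"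
      unfolding sum.distrib scaleR_sum_left[symmetric] mat_act_eq[OF c(1) j, symmetric] c(3)[OF j]
      by simp
    also have "mat_act C f j + (u i j - mat_act B (mat_act C f) i) = 2 *\<^sub>R u i j"
      by (simp add: u_def scaleR_2)
    also have "(1/2) *\<^sub>R (2 *\<^sub>R u i j) = u i j" by simp
    finally have "(N (u i j))\<^sup>2 \<le> (\<Sum>k<n. C $$ (j, k) * (N ((1/2) *\<^sub>R (u i j + v i k)))\<^sup>2)"
      using is_norm_jensen[OF N, of "{..<n}" "\<lambda>k. C $$ (j, k)" "\<lambda>k. (1/2) *\<^sub>R (u i j + v i k)"] c j
      by simp
    also have "\<dots> \<le> (\<Sum>k<n. C $$ (j, k) *
        (\<kappa> * ((N (u i j))\<^sup>2 + (N (v i k))\<^sup>2) - \<delta> * (N (u i j - v i k))\<^sup>2))"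
      using c(2) j mid by (intro sum_mono mult_left_mono) (auto simp: le_diff_eq)
    also have "\<dots> = (\<Sum>k<n. C $$ (j, k)) * (\<kappa> * (N (u i j))\<^sup>2)
        + \<kappa> * (\<Sum>k<n. C $$ (j, k) * (N (v i k))\<^sup>2)
        - \<delta> * (\<Sum>k<n. C $$ (j, k) * (N (u i j - v i k))\<^sup>2)"
      by (simp add: sum_distrib_left sum_distrib_right sum.distrib[symmetric]
          sum_subtractf[symmetric] algebra_simps)
    finally show ?thesis
      unfolding uv using c(3)[OF j]
      by (simp add: is_norm_minus_commute[OF N, of "mat_act C f j"] algebra_simps)
  qed
  define S where "S F = (\<Sum>i<n. \<Sum>j<n. B $$ (i, j) * F i j)" for F :: "nat \<Rightarrow> nat \<Rightarrow> real"
  have lin: "S (\<lambda>i j. F i j + c * G i j) = S F + c * S G"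
    and scale: "S (\<lambda>i j. c * G i j) = c * S G" for F G c
    by (simp_all add: S_def distrib_left sum.distrib sum_distrib_left mult.left_commute)
  \<comment> \<open>Stationarity: column sums of 1 make the marginal in \<open>j\<close> uniform, so
    the inner increment contributes the dispersion of \<open>C\<close>.\<close>
  have marg: "S (\<lambda>i. h) = (\<Sum>j<n. h j)" for h
    unfolding S_def by (subst sum.swap) (simp add: sum_distrib_right[symmetric] b(4))
  have lhs: "dispersion N n B (mat_act C f) + \<delta> * dispersion N n C f
      = S (\<lambda>i j. (N (u i j))\<^sup>2 + \<delta> * (\<Sum>k<n. C $$ (j, k) * (N (f k - mat_act C f j))\<^sup>2))"
    unfolding lin marg by (simp add: dispersion_def u_def S_def)
  have le: "S (\<lambda>i j. (N (u i j))\<^sup>2 + \<delta> * (\<Sum>k<n. C $$ (j, k) * (N (f k - mat_act C f j))\<^sup>2))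
      \<le> S (\<lambda>i j. \<kappa> * ((N (u i j))\<^sup>2 + 1 * (\<Sum>k<n. C $$ (j, k) * (N (v i k))\<^sup>2)))"
    unfolding S_def using b(2) pt by (intro sum_mono mult_left_mono) auto
  have "dispersion N n B (mat_act C f) = S (\<lambda>i j. (N (u i j))\<^sup>2)"
    by (simp only: dispersion_def u_def S_def)
  moreover have "dispersion N n (B * C) f = S (\<lambda>i j. \<Sum>k<n. C $$ (j, k) * (N (v i k))\<^sup>2)"
    by (simp only: dispersion_mult[OF B C] v_def S_def)
  ultimately show ?thesis
    using le unfolding lhs scale lin by simp
qed

section \<open>From one midpoint step to sums of squared increments\<close>

lemma dispersion_one:
  assumes "is_norm N"
  shows "dispersion N n (1\<^sub>m n) f = 0"
  unfolding dispersion_def mat_act_one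
  by (intro sum.neutral ballI) (auto simp: iffD2[OF is_norm_eq_0[OF assms]])

lemma mat_act_pow_Suc:
  assumes "C \<in> carrier_mat n n"
  shows "mat_act C (mat_act (C ^\<^sub>m k) f) = mat_act (C ^\<^sub>m Suc k) f"
proof -
  have "C ^\<^sub>m Suc k = C * C ^\<^sub>m k"
    using pow_mat_add[OF assms, of 1 k] assms by simp
  then show ?thesis using assms by (simp add: mat_act_mult del: pow_mat.simps)
qed

text \<open>Telescoping \<open>E|M\<^sub>k - M\<^sub>0|\<^sup>2\<close> along \<open>k\<close>; uniform convexity makes each step increase this
  quantity by a multiple of the squared increment.\<close>

lemma uniformly_convex_sum_dispersion:
  assumes N: "is_norm N" and uc: "uniformly_convex N"
  obtains r :: nat where "2 \<le> r"
    "\<And>n C f. doubly_stochastic n C \<Longrightarrow>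
       (\<Sum>k<r. dispersion N n C (mat_act (C ^\<^sub>m k) f)) \<le> (real r / 2) * dispersion N n (C ^\<^sub>m r) f"
proof -
  \<comment> \<open>With \<open>\<eta> = 1/8\<close> the errors accumulated over \<open>r\<close>
    steps take up half of the final bound \<open>r/2\<close>.\<close>
  obtain \<delta> where d: "0 < \<delta>"
    and mid: "\<And>u v. (N ((1/2) *\<^sub>R (u + v)))\<^sup>2 + \<delta> * (N (u - v))\<^sup>2
      \<le> (1/2 + \<delta> * (1/8)) * ((N u)\<^sup>2 + (N v)\<^sup>2)"
    using uniformly_convex_midpoint[OF N uc, of "1/8"] by auto
  \<comment> \<open>The condition \<open>2/\<delta> \<le> r\<close> lets the boundary term
    \<open>a r\<close> fit into the other half of the bound; adding 2 ensures
    \<open>2 \<le> r\<close>.\<close>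
  define r where "r = nat \<lceil>2/\<delta>\<rceil> + 2"
  have r: "2 \<le> r" "2/\<delta> \<le> real r" by (auto simp: r_def) linarith
  have "(\<Sum>k<r. dispersion N n C (mat_act (C ^\<^sub>m k) f)) \<le> (real r / 2) * dispersion N n (C ^\<^sub>m r) f"
    if C: "doubly_stochastic n C" for n C f
  proof -
    note c = doubly_stochasticD(1)[OF C]
    \<comment> \<open>Up to the factor \<open>n\<close>, \<open>a k\<close> is the second moment of
      the displacement from time 0 to time \<open>k\<close>. The increment from \<open>k\<close> to
      \<open>Suc k\<close> belongs to \<open>D (r - Suc k)\<close>, as the power counts the time
      left.\<close>
    define a where "a k = dispersion N n (C ^\<^sub>m k) (mat_act (C ^\<^sub>m (r - k)) f)" for k
    define D where "D k = dispersion N n C (mat_act (C ^\<^sub>m k) f)" for k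
    have shift: "mat_act C (mat_act (C ^\<^sub>m (r - Suc k)) f) = mat_act (C ^\<^sub>m (r - k)) f" if "k < r" for k
      using that by (simp add: mat_act_pow_Suc[OF c] Suc_diff_Suc del: pow_mat.simps)
    have ar: "a r = dispersion N n (C ^\<^sub>m r) f" using c by (simp add: a_def mat_act_one)
    have step: "a k + \<delta> * D (r - Suc k) \<le> (1/2 + \<delta> * (1/8)) * (a k + a (Suc k))" if "k < r" for k
      using dispersion_step[OF N doubly_stochastic_pow[OF C] C mid, of k "mat_act (C ^\<^sub>m (r - Suc k)) f"] that
      by (simp add: a_def D_def shift)
    have le: "a k \<le> a r" if "k \<le> r" for k
      using that
    proof (induction rule: inc_induct)
      case (step k)
      have "a k \<le> a (Suc k)"
        using dispersion_mat_act_le[OF N doubly_stochastic_pow[OF C] C, of k "mat_act (C ^\<^sub>m (r - Suc k)) f"] step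
        by (simp add: a_def shift)
      then show ?case using step by simp
    qed simp
    \<comment> \<open>The telescoping starts at \<open>a 0 = 0\<close>, and each error is bounded
      through \<open>a k \<le> a r\<close>.\<close>
    have tel: "2 * \<delta> * (\<Sum>i<k. D (r - Suc i)) \<le> a k + \<delta>/2 * real k * a r" if "k \<le> r" for k
      using that
    proof (induction k)
      case 0
      then show ?case using c by (simp add: a_def dispersion_one[OF N])
    next
      case (Suc k)
      have "2 * \<delta> * D (r - Suc k) \<le> a (Suc k) - a k + \<delta>/4 * (a k + a (Suc k))"
        using step[of k] Suc by (simp add: algebra_simps)
      also have "\<delta>/4 * (a k + a (Suc k)) \<le> \<delta>/4 * (2 * a r)"
        using le[of k] le[of "Suc k"] Suc d by (intro mult_left_mono) auto
      finally show ?case using Suc by (simp add: algebra_simps add_divide_distrib)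
    qed
    have "2 * \<delta> * (\<Sum>k<r. D k) \<le> a r + \<delta>/2 * real r * a r"
      using tel[of r] by (simp add: sum.nat_diff_reindex)
    moreover have "a r \<le> \<delta>/2 * real r * a r"
    proof -
      have "1 \<le> \<delta>/2 * real r" using r(2) d by (simp add: field_simps)
      moreover have "0 \<le> a r" using le[of 0] c by (simp add: a_def dispersion_one[OF N])
      ultimately show ?thesis using mult_right_mono[of 1 "\<delta>/2 * real r" "a r"] by simp
    qed
    ultimately have "2 * \<delta> * (\<Sum>k<r. D k) \<le> 2 * \<delta> * (real r / 2 * a r)" by simp
    then have "(\<Sum>k<r. D k) \<le> real r / 2 * a r" using d by (subst (asm) mult_le_cancel_left_pos) auto
    then show ?thesis by (simp add: D_def ar)
  qed
  with r(1) show thesis by (rule that)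
qed

text \<open>The constant is submultiplicative in the length: group the increments into blocks.\<close>

lemma sum_dispersion_pow:
  assumes base: "\<And>C f. doubly_stochastic n C \<Longrightarrow>
       (\<Sum>k<r. dispersion N n C (mat_act (C ^\<^sub>m k) f)) \<le> q * dispersion N n (C ^\<^sub>m r) f"
    and q: "0 \<le> q" and A: "doubly_stochastic n A"
  shows "(\<Sum>k<r ^ l. dispersion N n A (mat_act (A ^\<^sub>m k) f)) \<le> q ^ l * dispersion N n (A ^\<^sub>m (r ^ l)) f"
proof (induction l arbitrary: f)
  case 0
  have "A \<in> carrier_mat n n" using doubly_stochasticD(1)[OF A] .
  then show ?case by (simp add: mat_act_one)
next
  case (Suc l)
  note a = doubly_stochasticD(1)[OF A]
  define C where "C = A ^\<^sub>m (r ^ l)"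
  have C: "doubly_stochastic n C" unfolding C_def by (rule doubly_stochastic_pow[OF A])
  have "(\<Sum>k<r ^ Suc l. dispersion N n A (mat_act (A ^\<^sub>m k) f))
      = (\<Sum>s<r. \<Sum>k\<in>{s * r ^ l..<s * r ^ l + r ^ l}. dispersion N n A (mat_act (A ^\<^sub>m k) f))"
    by (simp add: sum.nat_group)
  \<comment> \<open>Block \<open>s\<close> is a full sum of length \<open>r^l\<close> for the
    function \<open>C^s f\<close>. The induction hypothesis then leaves the base inequality for the
    kernel \<open>C\<close>.\<close>
  also have "\<dots> = (\<Sum>s<r. \<Sum>k<r ^ l. dispersion N n A (mat_act (A ^\<^sub>m k) (mat_act (C ^\<^sub>m s) f)))"
  proof (rule sum.cong[OF refl])
    fix s
    have "(\<Sum>k\<in>{s * r ^ l..<s * r ^ l + r ^ l}. dispersion N n A (mat_act (A ^\<^sub>m k) f))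
        = (\<Sum>k<r ^ l. dispersion N n A (mat_act (A ^\<^sub>m (k + r ^ l * s)) f))"
      using sum.shift_bounds_nat_ivl[of "\<lambda>k. dispersion N n A (mat_act (A ^\<^sub>m k) f)" 0 "s * r ^ l" "r ^ l"]
      by (simp add: lessThan_atLeast0 mult.commute add.commute)
    also have "\<dots> = (\<Sum>k<r ^ l. dispersion N n A (mat_act (A ^\<^sub>m k) (mat_act (C ^\<^sub>m s) f)))"
      using a by (simp add: pow_mat_add[OF a] pow_mat_mult[OF a] mat_act_mult[of _ n] C_def)
    finally show "(\<Sum>k\<in>{s * r ^ l..<s * r ^ l + r ^ l}. dispersion N n A (mat_act (A ^\<^sub>m k) f)) = \<dots>" .
  qed
  also have "\<dots> \<le> (\<Sum>s<r. q ^ l * dispersion N n C (mat_act (C ^\<^sub>m s) f))"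
    unfolding C_def by (intro sum_mono Suc)
  also have "\<dots> \<le> q ^ l * (q * dispersion N n (C ^\<^sub>m r) f)"
    unfolding sum_distrib_left[symmetric] using q by (intro mult_left_mono base[OF C]) auto
  also have "\<dots> = q ^ Suc l * dispersion N n (A ^\<^sub>m (r ^ Suc l)) f"
    by (simp add: C_def pow_mat_mult[OF a, symmetric] mult.commute)
  finally show ?case .
qed

text \<open>The blocks are iterated in the uniformly convex norm. The norms are compared only at the
  two ends, so the loss \<open>K\<close> does not grow with \<open>l\<close>.\<close>

lemma super_reflexive_sum_dispersion:
  assumes "super_reflexive TYPE('a::real_normed_vector)"
  obtains r :: nat and K :: real where "2 \<le> r" "1 \<le> K"
    "\<And>n A l (f :: nat \<Rightarrow> 'a). doubly_stochastic n A \<Longrightarrow>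
       (\<Sum>k<r ^ l. dispersion norm n A (mat_act (A ^\<^sub>m k) f))
         \<le> K * (real r / 2) ^ l * dispersion norm n (A ^\<^sub>m (r ^ l)) f"
proof -
  obtain N :: "'a \<Rightarrow> real" and c C where N: "is_norm N" and uc: "uniformly_convex N"
    and c: "0 < c" "0 < C" and eq: "\<And>x. c * norm x \<le> N x" "\<And>x. N x \<le> C * norm x"
    using assms unfolding super_reflexive_def equivalent_norm_def by metis
  obtain r :: nat where r: "2 \<le> r"
    and base: "\<And>n B f. doubly_stochastic n B \<Longrightarrow>
       (\<Sum>k<r. dispersion N n B (mat_act (B ^\<^sub>m k) f)) \<le> (real r / 2) * dispersion N n (B ^\<^sub>m r) f"
    using uniformly_convex_sum_dispersion[OF N uc] by metis
  \<comment> \<open>In the zero space \<open>c\<close> and \<open>C\<close> are unrelated, hence the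
    maximum with 1.\<close>
  define K where "K = max 1 ((C / c)\<^sup>2)"
  have "(\<Sum>k<r ^ l. dispersion norm n A (mat_act (A ^\<^sub>m k) f))
         \<le> K * (real r / 2) ^ l * dispersion norm n (A ^\<^sub>m (r ^ l)) f"
    if A: "doubly_stochastic n A" for n A l and f :: "nat \<Rightarrow> 'a"
  proof -
    have lower: "c\<^sup>2 * dispersion norm n B g \<le> dispersion N n B g"
      and upper: "dispersion N n B g \<le> C\<^sup>2 * dispersion norm n B g"
      if B: "doubly_stochastic n B" for B g
    proof -
      note b = doubly_stochasticD(2)[OF B]
      have "c\<^sup>2 * (norm x)\<^sup>2 \<le> (N x)\<^sup>2" "(N x)\<^sup>2 \<le> C\<^sup>2 * (norm x)\<^sup>2" for x
        unfolding power_mult_distrib[symmetric]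
        using eq[of x] c is_norm_ge_0[OF N] by (auto intro!: power_mono)
      then show "c\<^sup>2 * dispersion norm n B g \<le> dispersion N n B g"
        "dispersion N n B g \<le> C\<^sup>2 * dispersion norm n B g"
        unfolding dispersion_def sum_distrib_left mult.left_commute[of _ "_ $$ _"]
        using b by (auto intro!: sum_mono mult_left_mono)
    qed
    have nn: "0 \<le> dispersion norm n (A ^\<^sub>m (r ^ l)) f"
      using doubly_stochasticD(2)[OF doubly_stochastic_pow[OF A]]
      unfolding dispersion_def by (intro sum_nonneg mult_nonneg_nonneg) auto
    have "c\<^sup>2 * (\<Sum>k<r ^ l. dispersion norm n A (mat_act (A ^\<^sub>m k) f))
        \<le> (\<Sum>k<r ^ l. dispersion N n A (mat_act (A ^\<^sub>m k) f))"
      unfolding sum_distrib_left by (intro sum_mono lower[OF A])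
    also have "\<dots> \<le> (real r / 2) ^ l * dispersion N n (A ^\<^sub>m (r ^ l)) f"
      by (rule sum_dispersion_pow[OF base _ A]) auto
    also have "\<dots> \<le> (real r / 2) ^ l * (C\<^sup>2 * dispersion norm n (A ^\<^sub>m (r ^ l)) f)"
      by (intro mult_left_mono upper doubly_stochastic_pow[OF A]) auto
    finally have "(\<Sum>k<r ^ l. dispersion norm n A (mat_act (A ^\<^sub>m k) f))
        \<le> (C / c)\<^sup>2 * ((real r / 2) ^ l * dispersion norm n (A ^\<^sub>m (r ^ l)) f)"
      using c by (simp add: power_divide field_simps)
    also have "\<dots> \<le> K * ((real r / 2) ^ l * dispersion norm n (A ^\<^sub>m (r ^ l)) f)"
      using nn by (intro mult_right_mono) (auto simp: K_def)
    finally show ?thesis by (simp add: mult.assoc)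
  qed
  with r show thesis by (intro that[of r K]) (auto simp: K_def)
qed

section \<open>Transferring the Poincare inequality\<close>

text \<open>The energy on the bipartite double cover of the weighted graph \<open>B\<close>:
  \<open>x\<close> lives on one copy of the vertices, \<open>y\<close> on the other.\<close>

definition bip_energy :: "nat \<Rightarrow> real mat \<Rightarrow> (nat \<Rightarrow> 'a::real_normed_vector) \<Rightarrow> (nat \<Rightarrow> 'a) \<Rightarrow> real" where
  "bip_energy n B x y = (\<Sum>i<n. \<Sum>j<n. B $$ (i, j) * (norm (x i - y j))\<^sup>2)"

lemma bip_energy_nonneg:
  assumes "doubly_stochastic n B"
  shows "0 \<le> bip_energy n B x y"
  using doubly_stochasticD(2)[OF assms] unfolding bip_energy_def by (intro sum_nonneg) simp

lemma bip_energy_swap: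
  assumes B: "B \<in> carrier_mat n n" and sym: "transpose_mat B = B"
  shows "bip_energy n B x y = bip_energy n B y x"
proof -
  have *: "B $$ (i, j) = B $$ (j, i)" if "i < n" "j < n" for i j
    using B sym that index_transpose_mat(1)[of j B i] by auto
  show ?thesis
    unfolding bip_energy_def
    by (subst sum.swap, intro sum.cong) (auto simp: * norm_minus_commute)
qed

section \<open>Convexity estimates for energies and dispersions\<close>

lemma norm_mat_act_jensen:
  fixes f :: "nat \<Rightarrow> 'a::real_normed_vector"
  assumes "doubly_stochastic n C" "j < n"
  shows "(norm (w - mat_act C f j))\<^sup>2 \<le> (\<Sum>k<n. C $$ (j, k) * (norm (w - f k))\<^sup>2)"
  using mat_act_jensen[OF is_norm_norm assms, of f w] by (simp add: norm_minus_commute)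

lemma sum_norm_mat_act_le:
  assumes "doubly_stochastic n B"
  shows "(\<Sum>i<n. (norm (x i - mat_act B y i))\<^sup>2) \<le> bip_energy n B x y"
  unfolding bip_energy_def by (intro sum_mono norm_mat_act_jensen[OF assms]) simp

text \<open>Jensen uses the row sums, and summing over the rows uses the column sums.\<close>

lemma mat_act_contraction:
  fixes f :: "nat \<Rightarrow> 'a::real_normed_vector"
  assumes B: "doubly_stochastic n B"
  shows "(\<Sum>i<n. (norm (mat_act B f i - mat_act B g i))\<^sup>2) \<le> (\<Sum>i<n. (norm (f i - g i))\<^sup>2)"
proof -
  note b = doubly_stochasticD[OF B]
  have "(norm (mat_act B f i - mat_act B g i))\<^sup>2 \<le> (\<Sum>j<n. B $$ (i, j) * (norm (f j - g j))\<^sup>2)"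
    if i: "i < n" for i
  proof -
    have "mat_act B f i - mat_act B g i = (\<Sum>j<n. B $$ (i, j) *\<^sub>R (f j - g j))"
      by (simp add: mat_act_eq[OF b(1) i] sum_subtractf scaleR_diff_right)
    then show ?thesis
      using is_norm_jensen[OF is_norm_norm, of "{..<n}" "\<lambda>j. B $$ (i, j)" "\<lambda>j. f j - g j"] b i by simp
  qed
  then have "(\<Sum>i<n. (norm (mat_act B f i - mat_act B g i))\<^sup>2)
      \<le> (\<Sum>i<n. \<Sum>j<n. B $$ (i, j) * (norm (f j - g j))\<^sup>2)"
    by (intro sum_mono) simp
  also have "\<dots> = (\<Sum>j<n. (norm (f j - g j))\<^sup>2)"
    by (subst sum.swap) (simp add: sum_distrib_right[symmetric] b(4))
  finally show ?thesis .
qed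

text \<open>An arbitrary \<open>x i\<close> is inserted between \<open>g j\<close> and its
  conditional mean. Both distances are bounded by the energy for \<open>B\<close>, and Jensen for
  \<open>C\<close> returns from \<open>g\<close> to \<open>f\<close>.\<close>

lemma dispersion_le_bip_energy:
  fixes f :: "nat \<Rightarrow> 'a::real_normed_vector"
  assumes B: "doubly_stochastic n B" and C: "doubly_stochastic n C"
  shows "dispersion norm n B (mat_act C f) \<le> 4 * bip_energy n (B * C) x f"
proof -
  note b = doubly_stochasticD[OF B] and c = doubly_stochasticD[OF C]
  define g where "g = mat_act C f"
  have "dispersion norm n B g
      \<le> (\<Sum>i<n. \<Sum>j<n. B $$ (i, j) * (2 * (norm (x i - g j))\<^sup>2 + 2 * (norm (x i - mat_act B g i))\<^sup>2))"
    unfolding dispersion_def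
  proof (intro sum_mono mult_left_mono)
    fix i j
    show "(norm (g j - mat_act B g i))\<^sup>2 \<le> 2 * (norm (x i - g j))\<^sup>2 + 2 * (norm (x i - mat_act B g i))\<^sup>2"
      using is_norm_sq_triangle[OF is_norm_norm, of "g j - x i" "x i - mat_act B g i"]
      by (simp add: norm_minus_commute)
  qed (use b in auto)
  also have "\<dots> = 2 * bip_energy n B x g + 2 * (\<Sum>i<n. (\<Sum>j<n. B $$ (i, j)) * (norm (x i - mat_act B g i))\<^sup>2)"
    by (simp add: bip_energy_def sum_distrib_left sum_distrib_right distrib_left sum.distrib mult.left_commute)
  also have "(\<Sum>i<n. (\<Sum>j<n. B $$ (i, j)) * (norm (x i - mat_act B g i))\<^sup>2)
      = (\<Sum>i<n. (norm (x i - mat_act B g i))\<^sup>2)"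
    using b(3) by (intro sum.cong) auto
  also have "\<dots> \<le> bip_energy n B x g" by (rule sum_norm_mat_act_le[OF B])
  also have "bip_energy n B x g \<le> bip_energy n (B * C) x f"
    unfolding bip_energy_def sum_mat_mult[OF b(1) c(1)] g_def
    using b(2) by (intro sum_mono mult_left_mono norm_mat_act_jensen[OF C]) auto
  finally show ?thesis by (simp add: g_def)
qed

lemma norm_average_sq_le:
  fixes f :: "nat \<Rightarrow> 'a::real_normed_vector"
  assumes "0 < M"
  shows "(norm ((1 / real M) *\<^sub>R (\<Sum>k<M. f k)))\<^sup>2 \<le> (1 / real M) * (\<Sum>k<M. (norm (f k))\<^sup>2)"
  using is_norm_jensen[OF is_norm_norm, of "{..<M}" "\<lambda>k. 1 / real M" f] assms
  by (simp add: scaleR_sum_right sum_distrib_left)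

lemma norm_average_diff_sq_le:
  fixes f :: "nat \<Rightarrow> 'a::real_normed_vector"
  assumes "0 < M"
  shows "(norm (w - (1 / real M) *\<^sub>R (\<Sum>k<M. f k)))\<^sup>2 \<le> (1 / real M) * (\<Sum>k<M. (norm (w - f k))\<^sup>2)"
proof -
  have "w - (1 / real M) *\<^sub>R (\<Sum>k<M. f k) = (1 / real M) *\<^sub>R (\<Sum>k<M. w - f k)"
    using assms by (simp add: sum_subtractf scaleR_diff_right sum_constant_scaleR)
  then show ?thesis using norm_average_sq_le[OF assms, of "\<lambda>k. w - f k"] by simp
qed

lemma mat_act_sum:
  assumes "A \<in> carrier_mat n n" "i < n"
  shows "mat_act A (\<lambda>j. c *\<^sub>R (\<Sum>k\<in>S. F k j)) i = c *\<^sub>R (\<Sum>k\<in>S. mat_act A (F k) i)"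
proof -
  have "mat_act A (\<lambda>j. c *\<^sub>R (\<Sum>k\<in>S. F k j)) i = (\<Sum>j<n. \<Sum>k\<in>S. c *\<^sub>R (A $$ (i, j) *\<^sub>R F k j))"
    by (simp add: mat_act_eq[OF assms] scaleR_sum_right mult.commute)
  also have "\<dots> = (\<Sum>k\<in>S. \<Sum>j<n. c *\<^sub>R (A $$ (i, j) *\<^sub>R F k j))" by (rule sum.swap)
  also have "\<dots> = c *\<^sub>R (\<Sum>k\<in>S. mat_act A (F k) i)"
    by (simp only: mat_act_eq[OF assms] scaleR_sum_right)
  finally show ?thesis .
qed

text \<open>The increment is linear in the function, so the dispersion is convex in it.\<close>

lemma dispersion_average_le:
  fixes F :: "nat \<Rightarrow> nat \<Rightarrow> 'a::real_normed_vector"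
  assumes A: "doubly_stochastic n A" and M: "0 < M"
  shows "dispersion norm n A (\<lambda>j. (1 / real M) *\<^sub>R (\<Sum>k<M. F k j))
    \<le> (1 / real M) * (\<Sum>k<M. dispersion norm n A (F k))"
proof -
  note a = doubly_stochasticD[OF A]
  have "dispersion norm n A (\<lambda>j. (1 / real M) *\<^sub>R (\<Sum>k<M. F k j))
      \<le> (\<Sum>i<n. \<Sum>j<n. A $$ (i, j) * ((1 / real M) * (\<Sum>k<M. (norm (F k j - mat_act A (F k) i))\<^sup>2)))"
    unfolding dispersion_def
  proof (intro sum_mono mult_left_mono)
    fix i j assume "i \<in> {..<n}"
    then show "(norm ((1 / real M) *\<^sub>R (\<Sum>k<M. F k j)
        - mat_act A (\<lambda>j. (1 / real M) *\<^sub>R (\<Sum>k<M. F k j)) i))\<^sup>2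
      \<le> (1 / real M) * (\<Sum>k<M. (norm (F k j - mat_act A (F k) i))\<^sup>2)"
      using norm_average_sq_le[OF M, of "\<lambda>k. F k j - mat_act A (F k) i"]
      by (simp add: mat_act_sum[OF a(1)] sum_subtractf scaleR_diff_right)
  qed (use a in auto)
  also have "\<dots> = (\<Sum>i<n. \<Sum>j<n. \<Sum>k<M. (1 / real M) * (A $$ (i, j) * (norm (F k j - mat_act A (F k) i))\<^sup>2))"
    by (simp only: sum_distrib_left mult.left_commute[of "_ $$ _"])
  also have "\<dots> = (\<Sum>i<n. \<Sum>k<M. \<Sum>j<n. (1 / real M) * (A $$ (i, j) * (norm (F k j - mat_act A (F k) i))\<^sup>2))"
    by (intro sum.cong[OF refl] sum.swap)
  also have "\<dots> = (\<Sum>k<M. \<Sum>i<n. \<Sum>j<n. (1 / real M) * (A $$ (i, j) * (norm (F k j - mat_act A (F k) i))\<^sup>2))"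
    by (rule sum.swap)
  also have "\<dots> = (1 / real M) * (\<Sum>k<M. dispersion norm n A (F k))"
    by (simp only: dispersion_def sum_distrib_left)
  finally show ?thesis .
qed

text \<open>Going from \<open>y\<close> to \<open>A\<^sup>k y\<close> through \<open>A\<^sup>s x\<close> for every \<open>s \<le> k\<close> avoids the energy of the
  identity matrix, over which the average of the energies of the powers gives no control.\<close>

lemma pow_displacement_le:
  fixes x y :: "nat \<Rightarrow> 'a::real_normed_vector"
  assumes A: "symmetric_stochastic n A"
  shows "real (Suc k) * (\<Sum>j<n. (norm (y j - mat_act (A ^\<^sub>m k) y j))\<^sup>2)
    \<le> 4 * (\<Sum>s<Suc k. bip_energy n (A ^\<^sub>m s) x y)"
proof -
  have ds: "doubly_stochastic n A" by (rule symmetric_stochastic_imp_doubly_stochastic[OF A])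
  have a: "A \<in> carrier_mat n n" "transpose_mat A = A" using A by (auto simp: symmetric_stochastic_def)
  note p = doubly_stochastic_pow[OF ds]
  define e where "e s = bip_energy n (A ^\<^sub>m s) x y" for s
  define V where "V = (\<Sum>j<n. (norm (y j - mat_act (A ^\<^sub>m k) y j))\<^sup>2)"
  \<comment> \<open>Going from \<open>y\<close> to \<open>A^s x\<close> uses symmetry of
    \<open>A^s\<close>; going on to \<open>A^s (A^(k-s) y)\<close> uses that \<open>A^s\<close> is a
    contraction.\<close>
  have "V \<le> 2 * e s + 2 * e (k - s)" if "s \<le> k" for s
  proof -
    define z where "z = mat_act (A ^\<^sub>m s) x"
    define w where "w = mat_act (A ^\<^sub>m k) y"
    have w: "w = mat_act (A ^\<^sub>m s) (mat_act (A ^\<^sub>m (k - s)) y)"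
      using pow_mat_add[OF a(1), of s "k - s"] that a by (simp add: w_def mat_act_mult[symmetric, of _ n])
    have "V \<le> (\<Sum>j<n. 2 * (norm (y j - z j))\<^sup>2 + 2 * (norm (z j - w j))\<^sup>2)"
      unfolding V_def w_def[symmetric]
    proof (rule sum_mono)
      show "(norm (y j - w j))\<^sup>2 \<le> 2 * (norm (y j - z j))\<^sup>2 + 2 * (norm (z j - w j))\<^sup>2" for j
        using is_norm_sq_triangle[OF is_norm_norm, of "y j - z j" "z j - w j"] by simp
    qed
    also have "\<dots> = 2 * (\<Sum>j<n. (norm (y j - z j))\<^sup>2) + 2 * (\<Sum>j<n. (norm (z j - w j))\<^sup>2)"
      by (simp add: sum.distrib sum_distrib_left)
    also have "(\<Sum>j<n. (norm (y j - z j))\<^sup>2) \<le> e s"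
      using sum_norm_mat_act_le[OF p, of y s x] bip_energy_swap[of "A ^\<^sub>m s" n y x]
        pow_mat_symmetric[OF a, of s] a
      by (simp add: z_def e_def)
    also have "(\<Sum>j<n. (norm (z j - w j))\<^sup>2) \<le> e (k - s)"
      unfolding z_def w e_def
      by (rule order_trans[OF mat_act_contraction[OF p] sum_norm_mat_act_le[OF p]])
    finally show ?thesis by simp
  qed
  then have "(\<Sum>s<Suc k. V) \<le> (\<Sum>s<Suc k. 2 * e s + 2 * e (k - s))" by (intro sum_mono) auto
  \<comment> \<open>The map sending \<open>s\<close> to \<open>k - s\<close> permutes the summands,
    so both sums agree.\<close>
  also have "\<dots> = 2 * (\<Sum>s<Suc k. e s) + 2 * (\<Sum>s<Suc k. e (Suc k - Suc s))"
    by (simp only: sum.distrib sum_distrib_left diff_Suc_Suc)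
  also have "\<dots> = 4 * (\<Sum>s<Suc k. e s)" unfolding sum.nat_diff_reindex by simp
  finally show ?thesis by (simp add: V_def e_def)
qed

lemma sum_shift_le:
  fixes e :: "nat \<Rightarrow> real"
  assumes "\<And>t. 0 \<le> e t" "a + M \<le> m"
  shows "(\<Sum>k<M. e (a + k)) \<le> (\<Sum>t<m. e t)"
proof -
  have "(\<Sum>k<M. e (a + k)) = sum e {a..<a + M}"
    using sum.shift_bounds_nat_ivl[of e 0 a M] by (simp add: lessThan_atLeast0 add.commute)
  also have "\<dots> \<le> (\<Sum>t<m. e t)" using assms by (intro sum_mono2) auto
  finally show ?thesis .
qed

lemma norm_sq_triangle3: "(norm (a + b + c))\<^sup>2 \<le> 3 * ((norm a)\<^sup>2 + (norm b)\<^sup>2 + (norm c)\<^sup>2)"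
proof -
  have "(norm (a + b + c))\<^sup>2 \<le> (norm a + norm b + norm c)\<^sup>2"
    by (intro power_mono) (auto intro: norm_triangle_mono)
  also have "\<dots> = (norm a)\<^sup>2 + (norm b)\<^sup>2 + (norm c)\<^sup>2
      + 2 * norm a * norm b + 2 * norm a * norm c + 2 * norm b * norm c"
    by (simp add: power2_eq_square algebra_simps)
  also have "\<dots> \<le> 3 * ((norm a)\<^sup>2 + (norm b)\<^sup>2 + (norm c)\<^sup>2)"
    using sum_squares_bound[of "norm a" "norm b"] sum_squares_bound[of "norm a" "norm c"]
      sum_squares_bound[of "norm b" "norm c"] by simp
  finally show ?thesis .
qed

text \<open>The hypothesis is tested on the pair \<open>(A z, z)\<close>, where \<open>z\<close> is an average of
  \<open>A\<^sup>k y\<close> over a window of length \<open>M\<close>. The window starts at some \<open>h \<in> [M, 2M)\<close>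
  chosen such that \<open>A\<^sup>h\<^sup>+\<^sup>M\<close> has at most average energy.\<close>

lemma poincare_transfer:
  fixes x y :: "nat \<Rightarrow> 'a::real_normed_vector"
  assumes A: "symmetric_stochastic n A" and n: "0 < n" and M: "0 < M" and m: "3 * M \<le> m"
    and \<gamma>: "0 \<le> \<gamma>" and L: "0 \<le> L"
    and gap: "\<And>x y :: nat \<Rightarrow> 'a. (1 / (real n)\<^sup>2) * (\<Sum>i<n. \<Sum>j<n. (norm (x i - y j))\<^sup>2)
        \<le> \<gamma> / real n * bip_energy n A x y"
    and disp: "\<And>f :: nat \<Rightarrow> 'a. (\<Sum>k<M. dispersion norm n A (mat_act (A ^\<^sub>m k) f))
         \<le> L * dispersion norm n (A ^\<^sub>m M) f"
  shows "(1 / (real n)\<^sup>2) * (\<Sum>i<n. \<Sum>j<n. (norm (x i - y j))\<^sup>2)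
    \<le> (15 + 12 * \<gamma> * (L / real M)) / real M * ((\<Sum>t<m. bip_energy n (A ^\<^sub>m t) x y) / real n)"
proof -
  have ds: "doubly_stochastic n A" by (rule symmetric_stochastic_imp_doubly_stochastic[OF A])
  have a: "A \<in> carrier_mat n n" using A by (auto simp: symmetric_stochastic_def)
  note p = doubly_stochastic_pow[OF ds]
  define e where "e t = bip_energy n (A ^\<^sub>m t) x y" for t
  define T where "T = (\<Sum>t<m. e t)"
  have e0: "0 \<le> e t" for t unfolding e_def by (rule bip_energy_nonneg[OF p])
  have T: "(\<Sum>k<M. e (s + k)) \<le> T" if "s + M \<le> m" for s
    unfolding T_def by (rule sum_shift_le[OF e0 that])
  \<comment> \<open>The \<open>M\<close> energies with exponents in \<open>[2M, 3M)\<close> sum to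
    at most \<open>T\<close>, so one of them is at most the average.\<close>
  have "\<exists>h'<M. e (2 * M + h') \<le> T / real M"
  proof (rule ccontr)
    assume "\<not> ?thesis"
    then have "(\<Sum>h'<M. T / real M) < (\<Sum>h'<M. e (2 * M + h'))"
      using M by (intro sum_strict_mono) auto
    then show False using T[of "2 * M"] m M by simp
  qed
  then obtain h' where h': "h' < M" "e (2 * M + h') \<le> T / real M" by blast
  define h where "h = M + h'"
  have h: "M \<le> h" "h < 2 * M" "e (M + h) \<le> T / real M"
    using h' by (simp_all add: h_def mult_2 add.assoc)
  define F where "F k = mat_act (A ^\<^sub>m (h + k)) y" for k
  define z where "z j = (1 / real M) *\<^sub>R (\<Sum>k<M. F k j)" for j
  have Az: "mat_act A z i = (1 / real M) *\<^sub>R (\<Sum>k<M. mat_act (A ^\<^sub>m (Suc h + k)) y i)" if "i < n" for i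
    unfolding z_def mat_act_sum[OF a that] by (simp add: F_def mat_act_pow_Suc[OF a] del: pow_mat.simps)
  \<comment> \<open>The vector \<open>A z\<close> averages \<open>A^(h+1+k) y\<close>. As
    \<open>h < 2 * M\<close>, the exponents stay below \<open>3 * M\<close>, so all the energies
    occur in \<open>T\<close>.\<close>
  have x_close: "(\<Sum>i<n. (norm (x i - mat_act A z i))\<^sup>2) \<le> T / real M"
  proof -
    have "(\<Sum>i<n. (norm (x i - mat_act A z i))\<^sup>2)
        \<le> (\<Sum>i<n. (1 / real M) * (\<Sum>k<M. (norm (x i - mat_act (A ^\<^sub>m (Suc h + k)) y i))\<^sup>2))"
      by (intro sum_mono) (simp only: Az lessThan_iff norm_average_diff_sq_le[OF M])
    also have "\<dots> = (1 / real M) * (\<Sum>k<M. \<Sum>i<n. (norm (x i - mat_act (A ^\<^sub>m (Suc h + k)) y i))\<^sup>2)"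
      unfolding sum_distrib_left by (rule sum.swap)
    also have "\<dots> \<le> (1 / real M) * (\<Sum>k<M. e (Suc h + k))"
      unfolding e_def by (intro mult_left_mono sum_mono sum_norm_mat_act_le[OF p]) simp
    also have "\<dots> \<le> (1 / real M) * T" using h m by (intro mult_left_mono T) auto
    finally show ?thesis by simp
  qed
  \<comment> \<open>The window starts at \<open>h \<ge> M\<close>, so each displacement bound is
    divided by more than \<open>M\<close>.\<close>
  have y_close: "(\<Sum>j<n. (norm (z j - y j))\<^sup>2) \<le> 4 * T / real M"
  proof -
    have "(\<Sum>j<n. (norm (z j - y j))\<^sup>2)
        \<le> (\<Sum>j<n. (1 / real M) * (\<Sum>k<M. (norm (y j - F k j))\<^sup>2))"
      unfolding z_def norm_minus_commute[of _ "y _"] by (intro sum_mono norm_average_diff_sq_le[OF M])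
    also have "\<dots> = (1 / real M) * (\<Sum>k<M. \<Sum>j<n. (norm (y j - F k j))\<^sup>2)"
      unfolding sum_distrib_left by (rule sum.swap)
    also have "\<dots> \<le> (1 / real M) * (\<Sum>k<M. 4 * T / real M)"
    proof (intro mult_left_mono sum_mono)
      fix k assume "k \<in> {..<M}"
      then have k: "Suc (h + k) \<le> m" "M \<le> Suc (h + k)" using h m by auto
      define V where "V = (\<Sum>j<n. (norm (y j - F k j))\<^sup>2)"
      have "real M * V \<le> real (Suc (h + k)) * V"
        using k by (intro mult_right_mono) (auto simp: V_def intro: sum_nonneg)
      also have "\<dots> \<le> 4 * (\<Sum>s<Suc (h + k). e s)"
        unfolding V_def F_def e_def by (rule pow_displacement_le[OF A])
      also have "(\<Sum>s<Suc (h + k). e s) \<le> T"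
        using sum_shift_le[OF e0, of 0 "Suc (h + k)" m] k by (simp add: T_def)
      finally show "V \<le> 4 * T / real M" using M by (simp add: field_simps)
    qed simp
    also have "\<dots> = 4 * T / real M" using M by simp
    finally show ?thesis .
  qed
  \<comment> \<open>The energy of \<open>(A z, z)\<close> is the dispersion of \<open>z\<close>.
    Convexity reduces it to the increments for \<open>A^h y\<close>, and \<open>disp\<close> leaves
    a single energy with exponent \<open>M + h\<close>, small by the choice of
    \<open>h\<close>.\<close>
  have smooth: "bip_energy n A (mat_act A z) z \<le> 4 * (L / real M) * (T / real M)"
  proof -
    have "bip_energy n A (mat_act A z) z = dispersion norm n A z"
      by (simp add: bip_energy_def dispersion_def norm_minus_commute)
    also have "\<dots> \<le> (1 / real M) * (\<Sum>k<M. dispersion norm n A (F k))"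
      unfolding z_def by (rule dispersion_average_le[OF ds M])
    also have "(\<Sum>k<M. dispersion norm n A (F k))
        = (\<Sum>k<M. dispersion norm n A (mat_act (A ^\<^sub>m k) (mat_act (A ^\<^sub>m h) y)))"
      using a by (simp add: F_def add.commute[of h] pow_mat_add[OF a] mat_act_mult[of _ n])
    also have "(1 / real M) * \<dots> \<le> (1 / real M) * (L * (4 * (T / real M)))"
    proof (rule mult_left_mono[OF order_trans[OF disp mult_left_mono]])
      have "dispersion norm n (A ^\<^sub>m M) (mat_act (A ^\<^sub>m h) y) \<le> 4 * e (M + h)"
        unfolding e_def pow_mat_add[OF a] by (rule dispersion_le_bip_energy[OF p p])
      then show "dispersion norm n (A ^\<^sub>m M) (mat_act (A ^\<^sub>m h) y) \<le> 4 * (T / real M)"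
        using h by linarith
    qed (use L in auto)
    finally show ?thesis by (simp add: ac_simps)
  qed
  \<comment> \<open>The path from \<open>x i\<close> to \<open>y j\<close> runs through
    \<open>A z\<close> at \<open>i\<close> and \<open>z\<close> at \<open>j\<close>: the outer
    pieces depend on one index only, and the middle one is handled by \<open>gap\<close>.\<close>
  have "(1 / (real n)\<^sup>2) * (\<Sum>i<n. \<Sum>j<n. (norm (x i - y j))\<^sup>2)
      \<le> (1 / (real n)\<^sup>2) * (\<Sum>i<n. \<Sum>j<n. 3 * ((norm (x i - mat_act A z i))\<^sup>2
          + (norm (mat_act A z i - z j))\<^sup>2 + (norm (z j - y j))\<^sup>2))"
  proof (intro mult_left_mono sum_mono)
    show "(norm (x i - y j))\<^sup>2 \<le> 3 * ((norm (x i - mat_act A z i))\<^sup>2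
          + (norm (mat_act A z i - z j))\<^sup>2 + (norm (z j - y j))\<^sup>2)" for i j
      using norm_sq_triangle3[of "x i - mat_act A z i" "mat_act A z i - z j" "z j - y j"] by simp
  qed simp
  also have "\<dots> = 3 * ((\<Sum>i<n. (norm (x i - mat_act A z i))\<^sup>2) / real n
      + (1 / (real n)\<^sup>2) * (\<Sum>i<n. \<Sum>j<n. (norm (mat_act A z i - z j))\<^sup>2)
      + (\<Sum>j<n. (norm (z j - y j))\<^sup>2) / real n)"
    using n by (simp add: sum.distrib sum_distrib_left[symmetric] power2_eq_square field_simps)
  also have "\<dots> \<le> 3 * ((T / real M) / real n + \<gamma> / real n * (4 * (L / real M) * (T / real M))
      + (4 * T / real M) / real n)"
    using x_close y_close order_trans[OF gap mult_left_mono[OF smooth]] \<gamma>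
    by (intro mult_left_mono add_mono divide_right_mono) auto
  also have "\<dots> = (15 + 12 * \<gamma> * (L / real M)) / real M * (T / real n)"
    using n M by (simp add: field_simps)
  finally show ?thesis by (simp add: T_def e_def)
qed

section \<open>The constant as an extended real number\<close>

lemma gamma_plus_leI:
  assumes n: "0 < dim_row A" and g: "0 < g"
    and nonneg: "\<And>x y. 0 \<le> (\<Sum>i<dim_row A. \<Sum>j<dim_row A. A $$ (i, j) * K (x i) (y j))"
    and le: "\<And>x y. (1 / (real (dim_row A))\<^sup>2) * (\<Sum>i<dim_row A. \<Sum>j<dim_row A. K (x i) (y j))
      \<le> g / real (dim_row A) * (\<Sum>i<dim_row A. \<Sum>j<dim_row A. A $$ (i, j) * K (x i) (y j))"
  shows "gamma_plus A K \<le> ennreal g"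
  unfolding gamma_plus_def Let_def
proof (rule Inf_lower, rule CollectI, intro conjI allI)
  show "0 < ennreal g" using g by simp
  show "ennreal ((1 / (real (dim_row A))\<^sup>2) * (\<Sum>i<dim_row A. \<Sum>j<dim_row A. K (x i) (y j)))
      \<le> ennreal g / ennreal (real (dim_row A)) *
        ennreal (\<Sum>i<dim_row A. \<Sum>j<dim_row A. A $$ (i, j) * K (x i) (y j))" for x y
    using n g nonneg[of x y] le[of x y]
    by (simp only: divide_ennreal ennreal_mult[symmetric] ennreal_leI less_imp_le of_nat_0_less_iff
        of_nat_0_le_iff divide_nonneg_pos)
qed

text \<open>A finite infimum is itself admissible: the inequality holds with
  \<open>\<gamma> + d\<close> for every \<open>d > 0\<close> and passes to the limit.\<close>

lemma gamma_plusD: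
  assumes n: "0 < dim_row A" and fin: "gamma_plus A K < top_class.top"
    and nonneg: "0 \<le> (\<Sum>i<dim_row A. \<Sum>j<dim_row A. A $$ (i, j) * K (x i) (y j))"
  shows "(1 / (real (dim_row A))\<^sup>2) * (\<Sum>i<dim_row A. \<Sum>j<dim_row A. K (x i) (y j))
      \<le> enn2real (gamma_plus A K) / real (dim_row A)
        * (\<Sum>i<dim_row A. \<Sum>j<dim_row A. A $$ (i, j) * K (x i) (y j))"
proof -
  define \<gamma> where "\<gamma> = enn2real (gamma_plus A K)"
  define V where "V = (1 / (real (dim_row A))\<^sup>2) * (\<Sum>i<dim_row A. \<Sum>j<dim_row A. K (x i) (y j))"
  define S where "S = (\<Sum>i<dim_row A. \<Sum>j<dim_row A. A $$ (i, j) * K (x i) (y j))"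
  have \<gamma>: "gamma_plus A K = ennreal \<gamma>" "0 \<le> \<gamma>" using fin by (simp_all add: \<gamma>_def)
  have S: "0 \<le> S" using nonneg by (simp add: S_def)
  have "V \<le> (\<gamma> + d) / real (dim_row A) * S" if d: "0 < d" for d
  proof -
    have "gamma_plus A K < ennreal (\<gamma> + d)" using \<gamma> d by (simp add: ennreal_less_iff)
    then obtain g where g: "g < ennreal (\<gamma> + d)"
      and le: "ennreal V \<le> g / ennreal (real (dim_row A)) * ennreal S"
      unfolding gamma_plus_def Let_def Inf_less_iff V_def S_def by blast
    note le
    also have "g / ennreal (real (dim_row A)) * ennreal S
        \<le> ennreal (\<gamma> + d) / ennreal (real (dim_row A)) * ennreal S"
      using g by (intro mult_right_mono divide_right_mono_ennreal) auto
    also have "\<dots> = ennreal ((\<gamma> + d) / real (dim_row A) * S)"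
      using n d \<gamma> S by (simp add: divide_ennreal flip: ennreal_mult del: ennreal_plus)
    finally show ?thesis using n d \<gamma> S by (subst (asm) ennreal_le_iff) auto
  qed
  then have *: "V \<le> \<gamma> / real (dim_row A) * S + d * (S / real (dim_row A))" if "0 < d" for d
    using that by (simp add: add_divide_distrib distrib_right)
  have "V \<le> \<gamma> / real (dim_row A) * S"
  proof (cases "S = 0")
    case True
    then show ?thesis using *[of 1] by simp
  next
    case False
    define s where "s = S / real (dim_row A)"
    have s: "0 < s" using False S n by (simp add: s_def)
    show ?thesis
    proof (rule field_le_epsilon)
      show "V \<le> \<gamma> / real (dim_row A) * S + d" if "0 < d" for d
        using *[of "d / s"] that s by (simp flip: s_def)
    qed
  qed
  then show ?thesis by (simp add: V_def S_def \<gamma>_def)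
qed

section \<open>Cesaro means, choice of the exponent and conclusion\<close>

lemma cesaro_bip_energy:
  assumes "A \<in> carrier_mat n n"
  shows "(\<Sum>i<n. \<Sum>j<n. cesaro_mat m A $$ (i, j) * norm_sq_kernel (x i) (y j))
    = (1 / real m) * (\<Sum>t<m. bip_energy n (A ^\<^sub>m t) x y)"
proof -
  have "(\<Sum>i<n. \<Sum>j<n. cesaro_mat m A $$ (i, j) * norm_sq_kernel (x i) (y j))
      = (\<Sum>i<n. \<Sum>j<n. \<Sum>t<m. (1 / real m) * ((A ^\<^sub>m t) $$ (i, j) * (norm (x i - y j))\<^sup>2))"
    using assms by (intro sum.cong)
      (auto simp: cesaro_mat_def norm_sq_kernel_def sum_distrib_left sum_distrib_right)
  also have "\<dots> = (\<Sum>i<n. \<Sum>t<m. \<Sum>j<n. (1 / real m) * ((A ^\<^sub>m t) $$ (i, j) * (norm (x i - y j))\<^sup>2))"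
    by (intro sum.cong[OF refl] sum.swap)
  also have "\<dots> = (\<Sum>t<m. \<Sum>i<n. \<Sum>j<n. (1 / real m) * ((A ^\<^sub>m t) $$ (i, j) * (norm (x i - y j))\<^sup>2))"
    by (rule sum.swap)
  also have "\<dots> = (1 / real m) * (\<Sum>t<m. bip_energy n (A ^\<^sub>m t) x y)"
    by (simp only: bip_energy_def sum_distrib_left)
  finally show ?thesis .
qed

text \<open>The window is the largest power \<open>r^l\<close> that fits three times into
  \<open>m\<close>. It is comparable to \<open>m\<close>, so the gain \<open>2^l\<close> is
  comparable to \<open>m\<close> to the power \<open>\<epsilon>\<close>.\<close>

lemma super_reflexive_poincare:
  assumes "super_reflexive TYPE('a::real_normed_vector)"
  obtains \<epsilon> C :: real where "0 < \<epsilon>" "0 < C"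
    "\<And>m n A \<gamma> (x :: nat \<Rightarrow> 'a) y. 2 \<le> m \<Longrightarrow> 0 < n \<Longrightarrow> symmetric_stochastic n A \<Longrightarrow> 0 \<le> \<gamma> \<Longrightarrow>
      (\<And>x y :: nat \<Rightarrow> 'a. (1 / (real n)\<^sup>2) * (\<Sum>i<n. \<Sum>j<n. (norm (x i - y j))\<^sup>2)
        \<le> \<gamma> / real n * bip_energy n A x y) \<Longrightarrow>
      (1 / (real n)\<^sup>2) * (\<Sum>i<n. \<Sum>j<n. (norm (x i - y j))\<^sup>2)
        \<le> C * max 1 (\<gamma> / real m powr \<epsilon>) / real n
          * ((1 / real m) * (\<Sum>t<m. bip_energy n (A ^\<^sub>m t) x y))"
proof -
  obtain r :: nat and K :: real where r: "2 \<le> r" and K: "1 \<le> K"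
    and disp: "\<And>n A l (f :: nat \<Rightarrow> 'a). doubly_stochastic n A \<Longrightarrow>
       (\<Sum>k<r ^ l. dispersion norm n A (mat_act (A ^\<^sub>m k) f))
         \<le> K * (real r / 2) ^ l * dispersion norm n (A ^\<^sub>m (r ^ l)) f"
    using super_reflexive_sum_dispersion[OF assms] by metis
  \<comment> \<open>This exponent turns \<open>r^l\<close> into \<open>2^l\<close>, the gain from
    \<open>l\<close> rounds of blocks.\<close>
  define \<epsilon> where "\<epsilon> = log (real r) 2"
  have \<epsilon>: "0 < \<epsilon>" "\<epsilon> \<le> 1" "real r powr \<epsilon> = 2" using r by (auto simp: \<epsilon>_def)
  \<comment> \<open>The cost of replacing \<open>m\<close> by the window length, which may be
    smaller by a factor \<open>3 * r\<close>.\<close>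
  define W where "W = (3 * real r) powr \<epsilon>"
  have W: "0 \<le> W" by (simp add: W_def)
  define C where "C = 3 * real r * (15 + 12 * K * W)"
  have "3 * 2 * (15 + 0) \<le> C" unfolding C_def using r K W by (intro mult_mono add_mono) auto
  then have C: "90 \<le> C" by simp
  have "(1 / (real n)\<^sup>2) * (\<Sum>i<n. \<Sum>j<n. (norm (x i - y j))\<^sup>2)
        \<le> C * max 1 (\<gamma> / real m powr \<epsilon>) / real n
          * ((1 / real m) * (\<Sum>t<m. bip_energy n (A ^\<^sub>m t) x y))"
    if m: "2 \<le> m" and n: "0 < n" and A: "symmetric_stochastic n A" and \<gamma>: "0 \<le> \<gamma>"
      and gap: "\<And>x y :: nat \<Rightarrow> 'a. (1 / (real n)\<^sup>2) * (\<Sum>i<n. \<Sum>j<n. (norm (x i - y j))\<^sup>2)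
        \<le> \<gamma> / real n * bip_energy n A x y"
    for m n A \<gamma> and x y :: "nat \<Rightarrow> 'a"
  proof -
    have ds: "doubly_stochastic n A" by (rule symmetric_stochastic_imp_doubly_stochastic[OF A])
    have a: "A \<in> carrier_mat n n" using A by (auto simp: symmetric_stochastic_def)
    define \<mu> where "\<mu> = max 1 (\<gamma> / real m powr \<epsilon>)"
    define T where "T = (\<Sum>t<m. bip_energy n (A ^\<^sub>m t) x y)"
    have e0: "0 \<le> bip_energy n (A ^\<^sub>m t) x y" for t
      by (rule bip_energy_nonneg[OF doubly_stochastic_pow[OF ds]])
    have T0: "0 \<le> T" unfolding T_def by (intro sum_nonneg e0)
    have \<mu>: "1 \<le> \<mu>" "\<gamma> \<le> \<mu> * real m powr \<epsilon>"
      using m by (auto simp: \<mu>_def field_simps max_def)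
    \<comment> \<open>The bound is first measured against \<open>T / n\<close>; restoring the factor
      \<open>1/m\<close> of the Cesaro mean makes \<open>q * m\<close> the quantity to
      estimate.\<close>
    obtain q where q: "(1 / (real n)\<^sup>2) * (\<Sum>i<n. \<Sum>j<n. (norm (x i - y j))\<^sup>2) \<le> q * (T / real n)"
      and qC: "q * real m \<le> C * \<mu>"
    proof (cases "m = 2")
      case True
      \<comment> \<open>For \<open>m = 2\<close> no window fits, but \<open>T\<close> contains the
        energy of \<open>A\<close>, so the hypothesis suffices.\<close>
      have "bip_energy n A x y \<le> T"
        using True e0[of 0] a by (simp add: T_def numeral_2_eq_2 left_mult_one_mat[of A n n])
      then have "\<gamma> / real n * bip_energy n A x y \<le> \<gamma> * (T / real n)"
        using n \<gamma> by (simp add: divide_right_mono mult_left_mono)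
      moreover have "\<gamma> * real m \<le> C * \<mu>"
      proof -
        have "real m powr \<epsilon> \<le> 2" using True \<epsilon> powr_mono[of \<epsilon> 1 2] by simp
        then have "\<mu> * real m powr \<epsilon> \<le> \<mu> * 2" using \<mu> by (intro mult_left_mono) auto
        then have "\<gamma> \<le> \<mu> * 2" using \<mu>(2) by linarith
        then have "\<gamma> * real m \<le> 4 * \<mu>" using True by simp
        also have "\<dots> \<le> C * \<mu>" using C \<mu> by (intro mult_right_mono) auto
        finally show ?thesis .
      qed
      ultimately show thesis using order_trans[OF gap] by (intro that[of \<gamma>]) auto
    next
      case False
      then have "1 \<le> m div 3" using m by auto
      then obtain l where l: "r ^ l \<le> m div 3" "m div 3 < r ^ (l + 1)"
        using ex_power_ivl1[OF r] by blast
      define M where "M = r ^ l"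
      have M: "0 < M" "3 * M \<le> m" "m \<le> 3 * r * M"
        using l r by (auto simp: M_def)
      have Mr: "real m \<le> 3 * real r * real M"
        using of_nat_mono[OF M(3), where ?'a = real] by simp
      have ratio: "K * (real r / 2) ^ l / real M = K / 2 ^ l"
        using r by (simp add: M_def power_divide)
      have "(1 / (real n)\<^sup>2) * (\<Sum>i<n. \<Sum>j<n. (norm (x i - y j))\<^sup>2)
          \<le> (15 + 12 * \<gamma> * (K / 2 ^ l)) / real M * (T / real n)"
        unfolding ratio[symmetric] T_def
      proof (rule poincare_transfer[OF A n M(1,2) \<gamma> _ gap])
        show "0 \<le> K * (real r / 2) ^ l" using K by simp
        show "(\<Sum>k<M. dispersion norm n A (mat_act (A ^\<^sub>m k) f))
            \<le> K * (real r / 2) ^ l * dispersion norm n (A ^\<^sub>m M) f" for f :: "nat \<Rightarrow> 'a"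
          unfolding M_def by (rule disp[OF ds])
      qed
      moreover have "(15 + 12 * \<gamma> * (K / 2 ^ l)) / real M * real m \<le> C * \<mu>"
      proof -
        have "real m powr \<epsilon> \<le> (3 * real r * real M) powr \<epsilon>"
          using Mr \<epsilon> by (intro powr_mono2) auto
        also have "\<dots> = W * real M powr \<epsilon>" by (simp add: W_def powr_mult)
        also have "real M powr \<epsilon> = (real r powr \<epsilon>) ^ l"
          using r by (simp add: M_def powr_powr powr_power mult.commute flip: powr_realpow)
        finally have "\<mu> * real m powr \<epsilon> \<le> \<mu> * (W * 2 ^ l)"
          using \<mu> \<epsilon>(3) by (intro mult_left_mono) auto
        then have "\<gamma> \<le> \<mu> * (W * 2 ^ l)" using \<mu>(2) by linarith
        then have "\<gamma> / 2 ^ l \<le> \<mu> * W" by (simp add: divide_le_eq mult.assoc)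
        then have "12 * K * (\<gamma> / 2 ^ l) \<le> 12 * K * (\<mu> * W)"
          using K by (intro mult_left_mono) auto
        then have "15 + 12 * \<gamma> * (K / 2 ^ l) \<le> (15 + 12 * K * W) * \<mu>"
          using \<mu> by (simp add: algebra_simps)
        moreover have "real m / real M \<le> 3 * real r"
          using M Mr by (simp add: divide_le_eq)
        ultimately have "(15 + 12 * \<gamma> * (K / 2 ^ l)) * (real m / real M)
            \<le> ((15 + 12 * K * W) * \<mu>) * (3 * real r)"
          using \<gamma> K W \<mu> by (intro mult_mono) auto
        then show ?thesis by (simp add: C_def mult_ac)
      qed
      ultimately show thesis by (rule that)
    qed
    have "q * (T / real n) = (q * real m) * (T / (real n * real m))" using m by simp
    also have "\<dots> \<le> (C * \<mu>) * (T / (real n * real m))"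
      using T0 by (intro mult_right_mono qC) auto
    finally show ?thesis using q by (simp add: \<mu>_def T_def)
  qed
  with \<epsilon>(1) C show thesis by (intro that[of \<epsilon> C]) auto
qed

theorem corollary1p10:
  assumes "super_reflexive TYPE('a::banach)"
  shows "\<exists>\<epsilon>::real. \<exists>C::real. 0 < \<epsilon> \<and> 0 < C \<and>
    (\<forall>(m::nat) (n::nat) (A::real mat).
       2 \<le> m \<longrightarrow> 1 \<le> n \<longrightarrow> symmetric_stochastic n A \<longrightarrow>
       gamma_plus (cesaro_mat m A) (norm_sq_kernel :: 'a \<Rightarrow> 'a \<Rightarrow> real)
         \<le> ennreal C * max 1 (gamma_plus A (norm_sq_kernel :: 'a \<Rightarrow> 'a \<Rightarrow> real)
                               / ennreal (real m powr \<epsilon>)))"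
proof -
  obtain \<epsilon> C :: real where \<epsilon>: "0 < \<epsilon>" and C: "0 < C"
    and poincare: "\<And>m n A \<gamma> (x :: nat \<Rightarrow> 'a) y. 2 \<le> m \<Longrightarrow> 0 < n \<Longrightarrow> symmetric_stochastic n A \<Longrightarrow> 0 \<le> \<gamma> \<Longrightarrow>
      (\<And>x y :: nat \<Rightarrow> 'a. (1 / (real n)\<^sup>2) * (\<Sum>i<n. \<Sum>j<n. (norm (x i - y j))\<^sup>2)
        \<le> \<gamma> / real n * bip_energy n A x y) \<Longrightarrow>
      (1 / (real n)\<^sup>2) * (\<Sum>i<n. \<Sum>j<n. (norm (x i - y j))\<^sup>2)
        \<le> C * max 1 (\<gamma> / real m powr \<epsilon>) / real n
          * ((1 / real m) * (\<Sum>t<m. bip_energy n (A ^\<^sub>m t) x y))"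
    using super_reflexive_poincare[OF assms] by blast
  have "gamma_plus (cesaro_mat m A) (norm_sq_kernel :: 'a \<Rightarrow> 'a \<Rightarrow> real)
      \<le> ennreal C * max 1 (gamma_plus A (norm_sq_kernel :: 'a \<Rightarrow> 'a \<Rightarrow> real) / ennreal (real m powr \<epsilon>))"
    if m: "2 \<le> m" and n: "1 \<le> n" and A: "symmetric_stochastic n A" for m n A
  proof (cases "gamma_plus A (norm_sq_kernel :: 'a \<Rightarrow> 'a \<Rightarrow> real) = top_class.top")
    case True
    \<comment> \<open>With \<open>C\<close> positive and a finite divisor, the right-hand side is
      infinite as well.\<close>
    then show ?thesis using C m by (simp add: ennreal_top_divide ennreal_mult_top)
  next
    case False
    define \<gamma> where "\<gamma> = enn2real (gamma_plus A (norm_sq_kernel :: 'a \<Rightarrow> 'a \<Rightarrow> real))"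
    have \<gamma>: "gamma_plus A (norm_sq_kernel :: 'a \<Rightarrow> 'a \<Rightarrow> real) = ennreal \<gamma>" "0 \<le> \<gamma>"
      using False by (simp_all add: \<gamma>_def less_top)
    have ds: "doubly_stochastic n A" by (rule symmetric_stochastic_imp_doubly_stochastic[OF A])
    have a: "A \<in> carrier_mat n n" "dim_row A = n" using A by (auto simp: symmetric_stochastic_def)
    have dim: "dim_row (cesaro_mat m A) = n" using a by (simp add: cesaro_mat_def)
    have energy: "(\<Sum>i<n. \<Sum>j<n. A $$ (i, j) * norm_sq_kernel (x i) (y j)) = bip_energy n A x y"
      for x y :: "nat \<Rightarrow> 'a"
      by (simp add: bip_energy_def norm_sq_kernel_def)
    have gap: "(1 / (real n)\<^sup>2) * (\<Sum>i<n. \<Sum>j<n. (norm (x i - y j))\<^sup>2) \<le> \<gamma> / real n * bip_energy n A x y"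
      for x y :: "nat \<Rightarrow> 'a"
      using gamma_plusD[of A "norm_sq_kernel :: 'a \<Rightarrow> 'a \<Rightarrow> real" x y] n False bip_energy_nonneg[OF ds, of x y]
      unfolding a(2) energy \<gamma>_def by (simp add: norm_sq_kernel_def less_top)
    have "gamma_plus (cesaro_mat m A) (norm_sq_kernel :: 'a \<Rightarrow> 'a \<Rightarrow> real)
        \<le> ennreal (C * max 1 (\<gamma> / real m powr \<epsilon>))"
    proof (rule gamma_plus_leI, unfold dim cesaro_bip_energy[OF a(1)])
      fix x y :: "nat \<Rightarrow> 'a"
      show "0 \<le> (1 / real m) * (\<Sum>t<m. bip_energy n (A ^\<^sub>m t) x y)"
        by (intro mult_nonneg_nonneg sum_nonneg bip_energy_nonneg doubly_stochastic_pow[OF ds]) simp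
      show "(1 / (real n)\<^sup>2) * (\<Sum>i<n. \<Sum>j<n. norm_sq_kernel (x i) (y j))
          \<le> C * max 1 (\<gamma> / real m powr \<epsilon>) / real n * ((1 / real m) * (\<Sum>t<m. bip_energy n (A ^\<^sub>m t) x y))"
        unfolding norm_sq_kernel_def using n by (intro poincare[OF m _ A \<gamma>(2) gap]) auto
    qed (use n C in auto)
    also have "\<dots> = ennreal C * max 1 (ennreal \<gamma> / ennreal (real m powr \<epsilon>))"
      using C m \<gamma> by (simp add: ennreal_mult divide_ennreal max_def ennreal_le_iff flip: ennreal_1)
    finally show ?thesis unfolding \<gamma>(1) .
  qed
  with \<epsilon> C show ?thesis by blast
qed

end
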